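(* Let $H=H_n\subseteq K_n$ be an arbitrary weakly dense sequence of graphs. Suppose that for $J^{(1)}\in\arg\max_{\emptyset\ne J\subseteq H}|J|/v(J)$ it holds that $q_1=|J^{(1)}|/|H|=\Omega(1)$ as $n\to\infty$. Then the planted subgraph model for $H$ has a sharp weak recovery threshold. Moreover, this threshold $p_{\mathrm{WR}}(H)$ is equal to the subgraph expectation threshold of $H$, that is, $$p_{\mathrm{WR}}(H)=(1+o(1))\max_{\emptyset\neq J\subseteq H}n^{-v(J)/|J|}.$$
   Context: A graph $T$ on vertex set $[n]$ is identified with its edge set; $|T|$ is its number of edges, $V(T)$ is the set of vertices incident to at least one edge of $T$, and $v(T)=|V(T)|$. Subgraph means subset of edges. A sequence of (nonempty) graphs $H=H_n\subseteq K_n$ is weakly dense if $\liminf_n \frac{|H_n|}{v(H_n)\log v(H_n)}=+\infty$. Planted subgraph model with noise level $p\in[0,1]$: $H^*$ is a uniformly random copy of $H_n$ in $K_n$, $G_0\sim G(n,p)$ is independent, and one observes $G=H^*\cup G_0$. Define $$\mathrm{MMSE}_n(p)=\frac1{|H|}\mathbb E\big[\|\mathbf 1_{H^*}-\mathbb E[\mathbf 1_{H^*}\mid G]\|_2^2\big],$$ where $\mathbf 1_{H^*}\in\{0,1\}^{\binom n2}$ is the indicator vector of the edges of $H^*$. For $\varepsilon\in(0,1)$ let $p_\varepsilon=p_\varepsilon(H_n)=\sup\{p\in[0,1]:\mathrm{MMSE}_n(p)\le1-\varepsilon\}$. The model for $H$ has a sharp weak recovery threshold if there is a constant $\varepsilon_0\in(0,1)$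 such that for all constants $0<\varepsilon<\varepsilon_0$, $p_\varepsilon=(1+o(1))p_{\varepsilon_0}$ as $n\to\infty$; in that case $p_{\mathrm{WR}}(H)=p_{\varepsilon_0}$ (well defined up to a factor $1+o(1)$). *)

theory Defs
  imports "HOL-Probability.Probability" "HOL-Library.Landau_Symbols"
begin

text \<open>A graph on the vertex set $\{1,\dots,n\}$ is identified with its set of edges, an edge being
  a two-element set of vertices.\<close>

type_synonym graph = "nat set set"

definition complete_graph :: "nat \<Rightarrow> graph" where
  "complete_graph n = {e. e \<subseteq> {1..n} \<and> card e = 2}"

text \<open>Isolated vertices do not count: only vertices incident to an edge do.\<close>

definition num_verts :: "graph \<Rightarrow> nat" where
  "num_verts T = card (\<Union>T)"

text \<open>There is no nonempty graph on fewer than two vertices, so graph sequences are only constrained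
  from \<open>n = 2\<close> on.\<close>

definition weakly_dense :: "(nat \<Rightarrow> graph) \<Rightarrow> bool" where
  "weakly_dense H \<longleftrightarrow>
     (\<forall>n\<ge>2. H n \<subseteq> complete_graph n \<and> H n \<noteq> {}) \<and>
     liminf (\<lambda>n. ereal (real (card (H n)) /
       (real (num_verts (H n)) * ln (real (num_verts (H n)))))) = \<infinity>"

definition copies :: "nat \<Rightarrow> graph \<Rightarrow> graph set" where
  "copies n T = {(\<lambda>e. \<sigma> ` e) ` T | \<sigma>. \<sigma> permutes {1..n}}"

definition erdos_renyi :: "nat \<Rightarrow> real \<Rightarrow> graph pmf" where
  "erdos_renyi n p =
     map_pmf (\<lambda>f. {e \<in> complete_graph n. f e})
       (Pi_pmf (complete_graph n) False (\<lambda>_. bernoulli_pmf p))"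

text \<open>The joint law of $(H^*, G_0)$; the observation is the union of the two components.\<close>

definition planted_model :: "nat \<Rightarrow> graph \<Rightarrow> real \<Rightarrow> (graph \<times> graph) pmf" where
  "planted_model n T p = pair_pmf (pmf_of_set (copies n T)) (erdos_renyi n p)"

definition observation :: "graph \<times> graph \<Rightarrow> graph" where
  "observation \<omega> = fst \<omega> \<union> snd \<omega>"

definition observation_algebra :: "(graph \<times> graph) measure" where
  "observation_algebra = vimage_algebra UNIV observation (count_space UNIV)"

definition edge_indicator :: "nat set \<Rightarrow> graph \<times> graph \<Rightarrow> real" where
  "edge_indicator e \<omega> = (if e \<in> fst \<omega> then 1 else 0)"

definition mmse :: "nat \<Rightarrow> graph \<Rightarrow> real \<Rightarrow> real" where
  "mmse n T p =
     1 / real (card T) *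
     measure_pmf.expectation (planted_model n T p)
       (\<lambda>\<omega>. \<Sum>e\<in>complete_graph n.
          (edge_indicator e \<omega> -
           real_cond_exp (measure_pmf (planted_model n T p)) observation_algebra
             (edge_indicator e) \<omega>)\<^sup>2)"

definition p_level :: "(nat \<Rightarrow> graph) \<Rightarrow> real \<Rightarrow> nat \<Rightarrow> real" where
  "p_level H \<epsilon> n = Sup {p \<in> {0..1}. mmse n (H n) p \<le> 1 - \<epsilon>}"

text \<open>Any two levels \<open>\<epsilon>\<^sub>0\<close> with the following property have asymptotically equivalent \<open>p_level H \<epsilon>\<^sub>0\<close>
  (compare both with a smaller \<open>\<epsilon>\<close>); the weak recovery threshold is this common value, up to a
  factor $1+o(1)$.\<close>

definition sharp_level :: "(nat \<Rightarrow> graph) \<Rightarrow> real \<Rightarrow> bool" where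
  "sharp_level H \<epsilon>\<^sub>0 \<longleftrightarrow> 0 < \<epsilon>\<^sub>0 \<and> \<epsilon>\<^sub>0 < 1 \<and>
     (\<forall>\<epsilon>. 0 < \<epsilon> \<and> \<epsilon> < \<epsilon>\<^sub>0 \<longrightarrow> p_level H \<epsilon> \<sim>[sequentially] p_level H \<epsilon>\<^sub>0)"

definition has_sharp_weak_recovery_threshold :: "(nat \<Rightarrow> graph) \<Rightarrow> bool" where
  "has_sharp_weak_recovery_threshold H \<longleftrightarrow> (\<exists>\<epsilon>\<^sub>0. sharp_level H \<epsilon>\<^sub>0)"

definition is_weak_recovery_threshold :: "(nat \<Rightarrow> graph) \<Rightarrow> (nat \<Rightarrow> real) \<Rightarrow> bool" where
  "is_weak_recovery_threshold H q \<longleftrightarrow>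
     has_sharp_weak_recovery_threshold H \<and>
     (\<forall>\<epsilon>\<^sub>0. sharp_level H \<epsilon>\<^sub>0 \<longrightarrow> p_level H \<epsilon>\<^sub>0 \<sim>[sequentially] q)"

definition subgraph_expectation_threshold :: "(nat \<Rightarrow> graph) \<Rightarrow> nat \<Rightarrow> real" where
  "subgraph_expectation_threshold H n =
     Max ((\<lambda>J. real n powr (- (real (num_verts J) / real (card J)))) ` {J. J \<noteq> {} \<and> J \<subseteq> H n})"

end

theory Submission
  imports Defs
begin

text \<open>
  Given $G$, the planted copy is uniform among the copies of $H$ contained in $G$. Write $d$ for the
  maximal density, so that the threshold is $q = n^{-1/d}$ and every subgraph $S$ of $H$ satisfies
  $q^{-|S|} \le n^{v(S)}$.

  For $p \ge (1+\delta)q$, let $X$ be the number of copies of $H$ in pure noise. Under the planted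
  law $X \ge t\,\mathbb E X$ holds with probability at least $1-t$ (change of measure, no concentration
  of $X$ needed), so two posterior samples overlap in at least $\eta|H|$ edges with probability at most
  $t + t^{-1}\,\mathbb E[p^{-|H'\cap H''|}; |H'\cap H''|\ge\eta|H|]$ for independent uniform copies
  $H', H''$. The gain $(1+\delta)^{-\eta|H|}$ beats
  $\mathbb E\,n^{|V(H')\cap V(H'')|} \le (v(v+1))^v$, where $v = v(H)$, by weak density.

  For $p = (1-\delta)q$, the estimator is any copy $J'$ of $J^{(1)}$ inside $G$. A union bound over the
  maps $V(J^{(1)}) \to [n]$ shows that every such copy shares most of its edges with $H^*$: the
  gain $(1-\delta)^{\eta|J^{(1)}|}$ beats the entropy $(v+1)^{v(J^{(1)})}$, again by weak density.
\<close>

section \<open>Copies of a graph\<close>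

lemma finite_complete_graph: "finite (complete_graph n)"
  by (rule finite_subset[of _ "Pow {1..n}"]) (auto simp: complete_graph_def)

lemma finite_subgraph: "T \<subseteq> complete_graph n \<Longrightarrow> finite T"
  using finite_complete_graph finite_subset by blast

lemma Union_subset_vertices: "T \<subseteq> complete_graph n \<Longrightarrow> \<Union>T \<subseteq> {1..n}"
  by (auto simp: complete_graph_def)

lemma finite_Union_subgraph: "T \<subseteq> complete_graph n \<Longrightarrow> finite (\<Union>T)"
  by (rule finite_subset[OF Union_subset_vertices finite_atLeastAtMost])

lemma num_verts_le: "T \<subseteq> complete_graph n \<Longrightarrow> num_verts T \<le> n"
  using card_mono[OF finite_atLeastAtMost Union_subset_vertices] by (fastforce simp: num_verts_def)

lemma num_verts_ge_2:
  assumes "T \<subseteq> complete_graph n" "T \<noteq> {}"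
  shows "2 \<le> num_verts T"
proof -
  obtain e where e: "e \<in> T" using assms by auto
  then have "card e = 2" using assms by (auto simp: complete_graph_def)
  moreover have "card e \<le> card (\<Union>T)"
    using e by (intro card_mono finite_Union_subgraph[OF assms(1)]) auto
  ultimately show ?thesis by (simp add: num_verts_def)
qed

lemma inj_image_permutes: "\<sigma> permutes A \<Longrightarrow> inj ((`) \<sigma>)"
  by (meson injI inj_image_eq_iff permutes_inj)

lemma copiesE:
  assumes "T' \<in> copies n T"
  obtains \<sigma> where "\<sigma> permutes {1..n}" "T' = (`) \<sigma> ` T"
  using assms by (auto simp: copies_def)

lemma Union_image_graph: "\<Union>((`) \<sigma> ` T) = \<sigma> ` \<Union>T"
  by auto

lemma self_mem_copies: "T \<in> copies n T"
  unfolding copies_def by (rule CollectI, rule exI[of _ id]) (simp add: permutes_id)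

lemma permutes_image_complete_graph:
  assumes "\<sigma> permutes {1..n}" "e \<in> complete_graph n"
  shows "\<sigma> ` e \<in> complete_graph n"
proof -
  have "card (\<sigma> ` e) = card e"
    by (intro card_image inj_on_subset[OF permutes_inj[OF assms(1)]]) auto
  moreover have "\<sigma> ` e \<subseteq> {1..n}"
    using assms permutes_image[OF assms(1)] by (auto simp: complete_graph_def)
  ultimately show ?thesis using assms(2) by (auto simp: complete_graph_def)
qed

lemma copies_subset_complete_graph:
  assumes "T \<subseteq> complete_graph n" "T' \<in> copies n T"
  shows "T' \<subseteq> complete_graph n"
proof -
  obtain \<sigma> where "\<sigma> permutes {1..n}" "T' = (`) \<sigma> ` T" using assms(2) by (rule copiesE)
  then show ?thesis
    using assms(1) permutes_image_complete_graph[of \<sigma> n] by (auto simp: subset_eq)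
qed

lemma finite_copies:
  assumes "T \<subseteq> complete_graph n"
  shows "finite (copies n T)"
proof (rule finite_subset)
  show "copies n T \<subseteq> Pow (complete_graph n)"
    using copies_subset_complete_graph[OF assms] by blast
qed (simp add: finite_complete_graph)

lemma card_copies_pos: "T \<subseteq> complete_graph n \<Longrightarrow> 0 < card (copies n T)"
  using finite_copies self_mem_copies by (metis card_gt_0_iff empty_iff)

lemma card_copy:
  assumes "T' \<in> copies n T"
  shows "card T' = card T"
proof -
  obtain \<sigma> where \<sigma>: "\<sigma> permutes {1..n}" "T' = (`) \<sigma> ` T" using assms by (rule copiesE)
  show ?thesis unfolding \<sigma>(2)
    by (intro card_image inj_on_subset[OF inj_image_permutes[OF \<sigma>(1)]]) auto
qed

lemma num_verts_image:
  assumes "\<sigma> permutes {1..n}"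
  shows "num_verts ((`) \<sigma> ` S) = num_verts S"
  unfolding num_verts_def Union_image_graph
  by (intro card_image inj_on_subset[OF permutes_inj[OF assms]]) auto

lemma num_verts_copy: "T' \<in> copies n T \<Longrightarrow> num_verts T' = num_verts T"
  by (elim copiesE) (simp add: num_verts_image)

lemma copies_mono:
  assumes "T' \<in> copies n T" "J \<subseteq> T"
  shows "\<exists>J'\<in>copies n J. J' \<subseteq> T'"
proof -
  obtain \<sigma> where "\<sigma> permutes {1..n}" "T' = (`) \<sigma> ` T" using assms(1) by (rule copiesE)
  then have "(`) \<sigma> ` J \<in> copies n J" "(`) \<sigma> ` J \<subseteq> T'"
    using assms(2) by (auto simp: copies_def)
  then show ?thesis by blast
qed

text \<open>An upper bound \<open>d\<close> on the maximal density |S| / v(S), multiplied out so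
  that the empty subgraph satisfies it as 0 <= 0.\<close>

definition density_le :: "graph \<Rightarrow> real \<Rightarrow> bool" where
  "density_le T d \<longleftrightarrow> (\<forall>S\<subseteq>T. real (card S) \<le> d * real (num_verts S))"

text \<open>Each subgraph of a copy is the image of a subgraph of \<open>T\<close> under the same
  permutation, with the same numbers of edges and vertices.\<close>

lemma density_le_copy:
  assumes "density_le T d" "T' \<in> copies n T"
  shows "density_le T' d"
  unfolding density_le_def
proof safe
  fix S' assume S': "S' \<subseteq> T'"
  obtain \<sigma> where \<sigma>: "\<sigma> permutes {1..n}" "T' = (`) \<sigma> ` T" using assms(2) by (rule copiesE)
  obtain S where S: "S \<subseteq> T" "S' = (`) \<sigma> ` S" using S' \<sigma>(2) by (auto simp: subset_image_iff)
  have "S' \<in> copies n S" using \<sigma> S by (auto simp: copies_def)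
  then show "real (card S') \<le> d * real (num_verts S')"
    using assms(1) S(1) by (simp add: density_le_def card_copy num_verts_copy)
qed

text \<open>The fibres of \<open>\<sigma> \<mapsto> \<sigma>(T)\<close> are cosets of the automorphism group of \<open>T\<close>, so they all have the
  same size.\<close>

lemma sum_copies_eq_sum_permutations:
  fixes h :: "graph \<Rightarrow> real"
  assumes T: "T \<subseteq> complete_graph n"
  shows "fact n * (\<Sum>T'\<in>copies n T. h T') =
         card (copies n T) * (\<Sum>\<sigma> | \<sigma> permutes {1..n}. h ((`) \<sigma> ` T))"
proof -
  define P where "P = {\<sigma>. \<sigma> permutes {1..n}}"
  define fib where "fib T' = {\<sigma>\<in>P. (`) \<sigma> ` T = T'}" for T'
  have finP: "finite P" unfolding P_def by (rule finite_permutations) simp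
  have img: "(\<lambda>\<sigma>. (`) \<sigma> ` T) ` P = copies n T" by (auto simp: P_def copies_def)
  have fib: "card (fib T') = card (fib T)" if T': "T' \<in> copies n T" for T'
  proof -
    obtain \<sigma> where \<sigma>: "\<sigma> permutes {1..n}" "T' = (`) \<sigma> ` T" using T' by (rule copiesE)
    have "bij_betw (\<lambda>\<tau>. \<sigma> \<circ> \<tau>) (fib T) (fib T')"
    proof (rule bij_betw_byWitness[where f' = "\<lambda>\<tau>. inv \<sigma> \<circ> \<tau>"])
      show "\<forall>\<tau>\<in>fib T. inv \<sigma> \<circ> (\<sigma> \<circ> \<tau>) = \<tau>"
        using permutes_inverses(2)[OF \<sigma>(1)] by (auto simp: fun_eq_iff)
      show "\<forall>\<tau>\<in>fib T'. \<sigma> \<circ> (inv \<sigma> \<circ> \<tau>) = \<tau>"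
        using permutes_inverses(1)[OF \<sigma>(1)] by (auto simp: fun_eq_iff)
      show "(\<lambda>\<tau>. \<sigma> \<circ> \<tau>) ` fib T \<subseteq> fib T'"
      proof (rule image_subsetI)
        fix \<tau> assume "\<tau> \<in> fib T"
        then have t: "\<tau> permutes {1..n}" "(`) \<tau> ` T = T" by (auto simp: fib_def P_def)
        have "(`) (\<sigma> \<circ> \<tau>) ` T = (`) \<sigma> ` ((`) \<tau> ` T)" by (simp add: image_image image_comp)
        then show "\<sigma> \<circ> \<tau> \<in> fib T'"
          using t \<sigma> permutes_compose[OF t(1) \<sigma>(1)] by (simp add: fib_def P_def)
      qed
      show "(\<lambda>\<tau>. inv \<sigma> \<circ> \<tau>) ` fib T' \<subseteq> fib T"
      proof (rule image_subsetI)
        fix \<tau> assume "\<tau> \<in> fib T'"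
        then have t: "\<tau> permutes {1..n}" "(`) \<tau> ` T = T'" by (auto simp: fib_def P_def)
        have "(`) (inv \<sigma> \<circ> \<tau>) ` T = (`) (inv \<sigma>) ` ((`) \<tau> ` T)"
          by (simp add: image_image image_comp)
        also have "\<dots> = (`) (inv \<sigma> \<circ> \<sigma>) ` T"
          unfolding t(2) \<sigma>(2) by (simp add: image_image image_comp)
        also have "inv \<sigma> \<circ> \<sigma> = id" using permutes_inv_o(2)[OF \<sigma>(1)] .
        finally show "inv \<sigma> \<circ> \<tau> \<in> fib T"
          using permutes_compose[OF t(1) permutes_inv[OF \<sigma>(1)]] by (simp add: fib_def P_def)
      qed
    qed
    then show ?thesis by (simp add: bij_betw_same_card)
  qed
  have sums: "(\<Sum>\<sigma>\<in>P. h' ((`) \<sigma> ` T)) = real (card (fib T)) * (\<Sum>T'\<in>copies n T. h' T')"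
    for h' :: "graph \<Rightarrow> real"
  proof -
    have "(\<Sum>\<sigma>\<in>P. h' ((`) \<sigma> ` T)) = (\<Sum>T'\<in>copies n T. \<Sum>\<sigma>\<in>fib T'. h' ((`) \<sigma> ` T))"
      unfolding fib_def img[symmetric] by (rule sum.image_gen[OF finP])
    also have "\<dots> = (\<Sum>T'\<in>copies n T. real (card (fib T)) * h' T')"
      by (intro sum.cong refl, subst fib[symmetric]) (auto simp: fib_def)
    finally show ?thesis by (simp add: sum_distrib_left)
  qed
  \<comment> \<open>Orbit-stabiliser: for the constant 1 the fibre identity reads n! = (fibre size)
    times (number of copies).\<close>
  have "fact n = real (card P)"
    unfolding P_def by (subst card_permutations[of _ n]) auto
  also have "\<dots> = real (card (fib T)) * real (card (copies n T))"
    using sums[of "\<lambda>_. 1"] by simp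
  finally show ?thesis
    unfolding P_def[symmetric] sums[of h] by (simp add: mult_ac)
qed

section \<open>Counting vertex maps by their overlap with a fixed vertex set\<close>

text \<open>Composing with the inverse of one such permutation makes all of them fix
  \<open>U\<close> pointwise, so they inject into the permutations of the complement. If
  \<open>f\<close> has no extension, the set is empty.\<close>

lemma card_permutes_extending_le:
  assumes "U \<subseteq> {1..n::nat}"
  shows "card {\<sigma>. \<sigma> permutes {1..n} \<and> restrict \<sigma> U = f} \<le> fact (n - card U)"
proof (cases "{\<sigma>. \<sigma> permutes {1..n} \<and> restrict \<sigma> U = f} = {}")
  case True
  then show ?thesis by (simp only: card.empty zero_le)
next
  case False
  then obtain \<sigma> where \<sigma>: "\<sigma> permutes {1..n}" "restrict \<sigma> U = f" by auto
  have "finite {\<tau>. \<tau> permutes {1..n} - U}" by (intro finite_permutations) auto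
  moreover have "inj_on (\<lambda>\<tau>. inv \<sigma> \<circ> \<tau>) {\<sigma>. \<sigma> permutes {1..n} \<and> restrict \<sigma> U = f}"
  proof (rule inj_onI)
    fix \<tau> \<tau>' assume "inv \<sigma> \<circ> \<tau> = inv \<sigma> \<circ> \<tau>'"
    then have "\<sigma> \<circ> (inv \<sigma> \<circ> \<tau>) = \<sigma> \<circ> (inv \<sigma> \<circ> \<tau>')" by simp
    then show "\<tau> = \<tau>'" using permutes_inverses(1)[OF \<sigma>(1)] by (auto simp: fun_eq_iff)
  qed
  moreover have "(\<lambda>\<tau>. inv \<sigma> \<circ> \<tau>) ` {\<sigma>. \<sigma> permutes {1..n} \<and> restrict \<sigma> U = f}
      \<subseteq> {\<tau>. \<tau> permutes {1..n} - U}"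
  proof (rule image_subsetI, rule CollectI)
    fix \<tau> assume "\<tau> \<in> {\<sigma>. \<sigma> permutes {1..n} \<and> restrict \<sigma> U = f}"
    then have \<tau>: "\<tau> permutes {1..n}" "restrict \<tau> U = restrict \<sigma> U" using \<sigma> by auto
    have "(inv \<sigma> \<circ> \<tau>) x = x" if "x \<in> U" for x
      using fun_cong[OF \<tau>(2), of x] that permutes_inverses(2)[OF \<sigma>(1)] by simp
    then show "inv \<sigma> \<circ> \<tau> permutes {1..n} - U"
      using permutes_superset[of "inv \<sigma> \<circ> \<tau>" "{1..n}" "{1..n} - U"]
        permutes_compose[OF \<tau>(1) permutes_inv[OF \<sigma>(1)]] by auto
  qed
  ultimately have "card {\<sigma>. \<sigma> permutes {1..n} \<and> restrict \<sigma> U = f} \<le>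
      card {\<tau>. \<tau> permutes {1..n} - U}"
    by (intro card_inj_on_le)
  also have "\<dots> = fact (n - card U)"
    using assms by (intro card_permutations) (auto simp: card_Diff_subset finite_subset)
  finally show ?thesis .
qed

text \<open>Compares n^v with the falling factorial n!/(n-v)!, that is, random maps with random
  injections, at the cost of a factor v^v. It follows from (n choose v) >= (n/v)^v and v! >=
  1.\<close>

lemma pow_times_fact_le:
  assumes "v \<le> n"
  shows "real n ^ v * fact (n - v) \<le> real v ^ v * fact n"
proof (cases "v = 0")
  case False
  have "(real n / real v) ^ v \<le> real (n choose v)"
    using binomial_ge_n_over_k_pow_k[OF assms] by simp
  also have "\<dots> = fact n / (fact v * fact (n - v))" by (rule binomial_fact[OF assms])
  also have "\<dots> \<le> fact n / (1 * fact (n - v))"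
    by (intro divide_left_mono mult_right_mono) auto
  finally show ?thesis using False by (simp add: power_divide field_simps)
qed simp

text \<open>The weight is a product over the vertices of \<open>U\<close>, so the sum over all maps
  factorises into one identical factor per vertex.\<close>

lemma sum_PiE_overlap:
  fixes a b :: real
  assumes "finite U" "V0 \<subseteq> {1..n::nat}"
  shows "(\<Sum>f\<in>U \<rightarrow>\<^sub>E {1..n}. \<Prod>u\<in>U. if f u \<in> V0 then a else b) =
    (real (card V0) * a + real (n - card V0) * b) ^ card U"
proof -
  have fin: "finite V0" using assms(2) finite_subset by blast
  have "(\<Sum>f\<in>U \<rightarrow>\<^sub>E {1..n}. \<Prod>u\<in>U. if f u \<in> V0 then a else b) =
      (\<Prod>u\<in>U. \<Sum>y\<in>{1..n}. if y \<in> V0 then a else b)"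
    using assms(1) by (subst prod_sum_PiE) auto
  also have "(\<Sum>y\<in>{1..n}. if y \<in> V0 then a else b) =
      real (card V0) * a + real (n - card V0) * b"
  proof -
    have "{1..n} \<inter> {y. y \<in> V0} = V0" "{1..n} \<inter> - {y. y \<in> V0} = {1..n} - V0"
      using assms(2) by auto
    then show ?thesis using assms(2) fin by (simp add: sum.If_cases card_Diff_subset)
  qed
  finally show ?thesis by simp
qed

lemma prod_overlap_eq_power:
  fixes a b :: real
  assumes "finite U"
  shows "(\<Prod>u\<in>U. if P u then a else b) =
    a ^ card {u\<in>U. P u} * b ^ (card U - card {u\<in>U. P u})"
proof -
  have "card (U \<inter> - {u. P u}) = card U - card {u\<in>U. P u}"
    using assms by (subst card_Diff_subset[symmetric]) (auto intro!: arg_cong[where f = card])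
  moreover have "U \<inter> {u. P u} = {u\<in>U. P u}" by auto
  ultimately show ?thesis using assms by (simp add: prod.If_cases)
qed

lemma card_image_Int:
  assumes "inj_on \<sigma> U"
  shows "card (V \<inter> \<sigma> ` U) = card {u\<in>U. \<sigma> u \<in> V}"
proof -
  have "V \<inter> \<sigma> ` U = \<sigma> ` {u\<in>U. \<sigma> u \<in> V}" by auto
  moreover have "inj_on \<sigma> {u\<in>U. \<sigma> u \<in> V}" using assms by (rule inj_on_subset) auto
  ultimately show ?thesis by (simp add: card_image)
qed

lemma restrict_permutes_PiE:
  assumes "\<sigma> permutes A" "U \<subseteq> A"
  shows "restrict \<sigma> U \<in> U \<rightarrow>\<^sub>E A"
proof -
  have "\<sigma> x \<in> A" if "x \<in> U" for x
    using that assms(2) permutes_in_image[OF assms(1), of x] by blast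
  then show ?thesis by simp
qed

text \<open>Give weight n to each vertex of the random copy that lands in \<open>V\<close>. An
  independent uniform vertex then weighs at most v + 1 on average, and replacing injections by
  arbitrary maps costs v^v.\<close>

lemma sum_copies_pow_overlap_le:
  assumes T: "T \<subseteq> complete_graph n" and n: "1 \<le> n"
    and V: "V \<subseteq> {1..n}" "card V = num_verts T"
  shows "(\<Sum>T'\<in>copies n T. real n ^ card (V \<inter> \<Union>T')) \<le>
    real (card (copies n T)) * (real (num_verts T) * (real (num_verts T) + 1)) ^ num_verts T"
proof -
  define U where "U = \<Union>T"
  define v where "v = num_verts T"
  define P where "P = {\<sigma>. \<sigma> permutes {1..n}}"
  define w where "w f = (\<Prod>u\<in>U. if f u \<in> V then real n else 1)" for f :: "nat \<Rightarrow> nat"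
  have cU: "card U = v" and finU: "finite U" and U: "U \<subseteq> {1..n}"
    using finite_Union_subgraph[OF T] Union_subset_vertices[OF T]
    by (auto simp: U_def v_def num_verts_def)
  have vn: "v \<le> n" using num_verts_le[OF T] by (simp add: v_def)
  have finP: "finite P" unfolding P_def by (rule finite_permutations) simp
  have w0: "0 \<le> w f" for f unfolding w_def by (intro prod_nonneg) auto
  have "(\<Sum>\<sigma>\<in>P. real n ^ card (V \<inter> \<Union>((`) \<sigma> ` T))) = (\<Sum>\<sigma>\<in>P. w (restrict \<sigma> U))"
  proof (rule sum.cong[OF refl])
    fix \<sigma> assume "\<sigma> \<in> P"
    then have "inj_on \<sigma> U" unfolding P_def using inj_on_subset[OF permutes_inj subset_UNIV] by blast
    then have "card (V \<inter> \<Union>((`) \<sigma> ` T)) = card {u\<in>U. \<sigma> u \<in> V}"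
      unfolding Union_image_graph U_def by (rule card_image_Int)
    moreover have "w (restrict \<sigma> U) = (\<Prod>u\<in>U. if \<sigma> u \<in> V then real n else 1)"
      unfolding w_def by (intro prod.cong) auto
    ultimately show "real n ^ card (V \<inter> \<Union>((`) \<sigma> ` T)) = w (restrict \<sigma> U)"
      using finU by (simp add: prod_overlap_eq_power)
  qed
  \<comment> \<open>The weight depends only on where \<open>U\<close> goes, so permutations are
    grouped by their restriction to \<open>U\<close>; each group has at most (n - v)!
    members.\<close>
  also have "\<dots> = (\<Sum>f\<in>(\<lambda>\<sigma>. restrict \<sigma> U) ` P. \<Sum>\<sigma> | \<sigma> \<in> P \<and> restrict \<sigma> U = f. w (restrict \<sigma> U))"
    by (rule sum.image_gen[OF finP])
  also have "\<dots> = (\<Sum>f\<in>(\<lambda>\<sigma>. restrict \<sigma> U) ` P. real (card {\<sigma>. \<sigma> permutes {1..n} \<and> restrict \<sigma> U = f}) * w f)"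
    by (intro sum.cong) (auto simp: P_def)
  also have "\<dots> \<le> (\<Sum>f\<in>(\<lambda>\<sigma>. restrict \<sigma> U) ` P. fact (n - v) * w f)"
  proof (intro sum_mono mult_right_mono)
    fix f
    have "real (card {\<sigma>. \<sigma> permutes {1..n} \<and> restrict \<sigma> U = f}) \<le> real (fact (n - v))"
      unfolding of_nat_le_iff using card_permutes_extending_le[OF U] cU by simp
    then show "real (card {\<sigma>. \<sigma> permutes {1..n} \<and> restrict \<sigma> U = f}) \<le> fact (n - v)" by simp
  qed (auto simp: w0)
  \<comment> \<open>The remaining maps, non-injective ones included, have nonnegative weight; adding
    them makes the sum factorise.\<close>
  also have "\<dots> \<le> (\<Sum>f\<in>U \<rightarrow>\<^sub>E {1..n}. fact (n - v) * w f)"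
  proof (intro sum_mono2)
    show "finite (U \<rightarrow>\<^sub>E {1..n})" using finU by (intro finite_PiE) auto
    show "(\<lambda>\<sigma>. restrict \<sigma> U) ` P \<subseteq> U \<rightarrow>\<^sub>E {1..n}"
      using restrict_permutes_PiE[OF _ U] unfolding P_def by blast
  qed (auto simp: w0)
  also have "\<dots> = fact (n - v) * (real v * real n + real (n - v)) ^ v"
    using sum_PiE_overlap[OF finU V(1), of "real n" 1] V(2)
    by (simp add: w_def sum_distrib_left[symmetric] cU v_def)
  also have "\<dots> \<le> fact (n - v) * (real n * (real v + 1)) ^ v"
    by (intro mult_left_mono power_mono) (auto simp: algebra_simps)
  also have "\<dots> = (real n ^ v * fact (n - v)) * (real v + 1) ^ v"
    by (simp add: power_mult_distrib)
  also have "\<dots> \<le> (real v ^ v * fact n) * (real v + 1) ^ v"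
    by (intro mult_right_mono pow_times_fact_le vn) auto
  finally have "(\<Sum>\<sigma>\<in>P. real n ^ card (V \<inter> \<Union>((`) \<sigma> ` T))) \<le>
      fact n * (real v * (real v + 1)) ^ v"
    by (simp add: power_mult_distrib mult_ac)
  then have "fact n * (\<Sum>T'\<in>copies n T. real n ^ card (V \<inter> \<Union>T')) \<le>
      real (card (copies n T)) * (fact n * (real v * (real v + 1)) ^ v)"
    unfolding sum_copies_eq_sum_permutations[OF T] P_def by (intro mult_left_mono) auto
  then have "fact n * (\<Sum>T'\<in>copies n T. real n ^ card (V \<inter> \<Union>T')) \<le>
      fact n * (real (card (copies n T)) * (real v * (real v + 1)) ^ v)"
    by (simp add: mult_ac)
  then show ?thesis unfolding v_def
    by (rule mult_left_le_imp_le) simp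
qed

text \<open>Each copy of \<open>J\<close> is charged to the restriction to \<open>V(J)\<close> of one permutation producing it.\<close>

lemma sum_copies_missing_le:
  assumes J: "J \<subseteq> complete_graph n" and n: "1 \<le> n"
    and V: "V \<subseteq> {1..n}"
  shows "(\<Sum>J'\<in>copies n J. (1 / real n) ^ (num_verts J - card (V \<inter> \<Union>J'))) \<le>
    (real (card V) + 1) ^ num_verts J"
proof -
  define U where "U = \<Union>J"
  define w where "w f = (\<Prod>u\<in>U. if f u \<in> V then 1 else 1 / real n)" for f :: "nat \<Rightarrow> nat"
  have cU: "card U = num_verts J" and finU: "finite U" and U: "U \<subseteq> {1..n}"
    using finite_Union_subgraph[OF J] Union_subset_vertices[OF J]
    by (auto simp: U_def num_verts_def)
  have "\<forall>J'\<in>copies n J. \<exists>\<sigma>. \<sigma> permutes {1..n} \<and> J' = (`) \<sigma> ` J"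
    by (auto simp: copies_def)
  then obtain s where s: "\<And>J'. J' \<in> copies n J \<Longrightarrow> s J' permutes {1..n} \<and> J' = (`) (s J') ` J"
    by metis
  \<comment> \<open>All edges of \<open>J\<close> lie inside \<open>U\<close>, so the restriction
    determines the copy.\<close>
  have inj: "inj_on (\<lambda>J'. restrict (s J') U) (copies n J)"
  proof (rule inj_onI)
    fix J' J'' assume a: "J' \<in> copies n J" "J'' \<in> copies n J" "restrict (s J') U = restrict (s J'') U"
    have "s J' x = s J'' x" if "x \<in> U" for x using fun_cong[OF a(3), of x] that by simp
    then have "(`) (s J') ` J = (`) (s J'') ` J"
      by (intro image_cong refl) (auto simp: U_def)
    then show "J' = J''" using s[OF a(1)] s[OF a(2)] by metis
  qed
  have "(\<Sum>J'\<in>copies n J. (1 / real n) ^ (num_verts J - card (V \<inter> \<Union>J'))) =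
      (\<Sum>J'\<in>copies n J. w (restrict (s J') U))"
  proof (rule sum.cong[OF refl])
    fix J' assume J': "J' \<in> copies n J"
    have "inj_on (s J') U"
      using inj_on_subset[OF permutes_inj[OF conjunct1[OF s[OF J']]] subset_UNIV] .
    moreover have "\<Union>J' = s J' ` U" unfolding U_def by (subst s[OF J', THEN conjunct2]) (rule Union_image_graph)
    ultimately have "card (V \<inter> \<Union>J') = card {u\<in>U. s J' u \<in> V}"
      by (simp add: card_image_Int)
    moreover have "w (restrict (s J') U) = (\<Prod>u\<in>U. if s J' u \<in> V then 1 else 1 / real n)"
      unfolding w_def by (intro prod.cong) auto
    ultimately show "(1 / real n) ^ (num_verts J - card (V \<inter> \<Union>J')) = w (restrict (s J') U)"
      using finU cU by (simp add: prod_overlap_eq_power)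
  qed
  also have "\<dots> = (\<Sum>f\<in>(\<lambda>J'. restrict (s J') U) ` copies n J. w f)"
    using inj by (simp add: sum.reindex)
  also have "\<dots> \<le> (\<Sum>f\<in>U \<rightarrow>\<^sub>E {1..n}. w f)"
  proof (intro sum_mono2)
    show "finite (U \<rightarrow>\<^sub>E {1..n})" using finU by (intro finite_PiE) auto
    show "(\<lambda>J'. restrict (s J') U) ` copies n J \<subseteq> U \<rightarrow>\<^sub>E {1..n}"
    proof (rule image_subsetI)
      fix J' assume "J' \<in> copies n J"
      then show "restrict (s J') U \<in> U \<rightarrow>\<^sub>E {1..n}"
        using restrict_permutes_PiE[OF _ U] s by blast
    qed
  qed (auto simp: w_def intro!: prod_nonneg)
  \<comment> \<open>Targets in \<open>V\<close> weigh 1 and the other n - |V| targets weigh 1/n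
    each, so every vertex contributes at most |V| + 1.\<close>
  also have "\<dots> = (real (card V) + real (n - card V) / real n) ^ num_verts J"
    using sum_PiE_overlap[OF finU V, of 1 "1 / real n"] by (simp add: w_def cU)
  also have "\<dots> \<le> (real (card V) + 1) ^ num_verts J"
    using n by (intro power_mono) (auto simp: field_simps)
  finally show ?thesis .
qed

section \<open>The planted model and its posterior\<close>

lemma finite_set_erdos_renyi: "finite (set_pmf (erdos_renyi n p))"
  by (rule finite_subset[of _ "Pow (complete_graph n)"])
    (auto simp: erdos_renyi_def finite_complete_graph)

lemma integrable_erdos_renyi [simp]:
  fixes f :: "graph \<Rightarrow> real"
  shows "integrable (measure_pmf (erdos_renyi n p)) f"
  by (rule integrable_measure_pmf_finite[OF finite_set_erdos_renyi])

section \<open>Planting a subgraph as a change of measure\<close>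

text \<open>Conditions on the coin of \<open>e\<close>, which is independent of the others;
  \<open>R\<close> is the law of the remaining coins and \<open>S\<close> the graph they
  produce.\<close>

lemma expectation_erdos_renyi_split:
  fixes h :: "graph \<Rightarrow> real"
  assumes p: "0 \<le> p" "p \<le> 1" and e: "e \<in> complete_graph n"
  defines "R \<equiv> Pi_pmf (complete_graph n - {e}) False (\<lambda>_. bernoulli_pmf p)"
  defines "S \<equiv> \<lambda>f. {x \<in> complete_graph n - {e}. f x}"
  shows "measure_pmf.expectation (erdos_renyi n p) h =
    p * measure_pmf.expectation R (\<lambda>f. h (insert e (S f))) +
    (1 - p) * measure_pmf.expectation R (\<lambda>f. h (S f))"
proof -
  let ?K = "complete_graph n"
  have fin: "finite (?K - {e})" using finite_complete_graph by simp
  have K: "?K = insert e (?K - {e})" using e by blast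
  have T: "{x \<in> ?K. (f(e := True)) x} = insert e (S f)" for f
    using e by (auto simp: S_def)
  have F: "{x \<in> ?K. (f(e := False)) x} = S f" for f
    by (auto simp: S_def)
  have "erdos_renyi n p =
      bernoulli_pmf p \<bind> (\<lambda>y. map_pmf (\<lambda>f. {x \<in> ?K. (f(e := y)) x}) R)"
    unfolding erdos_renyi_def R_def
    by (subst (2) K, subst Pi_pmf_insert'[OF fin])
      (simp_all add: map_bind_pmf bind_return_pmf map_pmf_def bind_assoc_pmf)
  moreover have "finite (set_pmf R)"
    unfolding R_def set_Pi_pmf[OF fin] by (intro finite_PiE_dflt[OF fin]) simp
  ultimately have "measure_pmf.expectation (erdos_renyi n p) h =
      (\<Sum>y\<in>UNIV. pmf (bernoulli_pmf p) y *\<^sub>R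
        measure_pmf.expectation (map_pmf (\<lambda>f. {x \<in> ?K. (f(e := y)) x}) R) h)"
    by (subst pmf_expectation_bind[symmetric, where A = UNIV and p = "bernoulli_pmf p"]) auto
  then show ?thesis
    using p by (simp add: UNIV_bool T F del: fun_upd_apply)
qed

text \<open>After splitting on \<open>e\<close>, both sides are p times the expectation with
  \<open>e\<close> forced into the graph.\<close>

lemma expectation_plant_edge:
  fixes h :: "graph \<Rightarrow> real"
  assumes p: "0 \<le> p" "p \<le> 1" and e: "e \<in> complete_graph n"
  shows "p * measure_pmf.expectation (erdos_renyi n p) (\<lambda>G. h (insert e G)) =
    measure_pmf.expectation (erdos_renyi n p) (\<lambda>G. h G * of_bool (e \<in> G))"
  unfolding expectation_erdos_renyi_split[OF assms]
  by (simp add: algebra_simps)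

text \<open>Planting \<open>S\<close> in the noise amounts to conditioning the noise on containing
  \<open>S\<close>, an event of probability p^|S|. The edges are planted one at a time.\<close>

lemma expectation_plant:
  fixes h :: "graph \<Rightarrow> real"
  assumes p: "0 \<le> p" "p \<le> 1" and S: "S \<subseteq> complete_graph n"
  shows "p ^ card S * measure_pmf.expectation (erdos_renyi n p) (\<lambda>G. h (S \<union> G)) =
    measure_pmf.expectation (erdos_renyi n p) (\<lambda>G. h G * of_bool (S \<subseteq> G))"
  using finite_subgraph[OF S] S
proof (induction S arbitrary: h rule: finite_induct)
  case (insert e S)
  let ?E = "measure_pmf.expectation (erdos_renyi n p)"
  have "p ^ card (insert e S) * ?E (\<lambda>G. h (insert e S \<union> G)) =
      p ^ card S * (p * ?E (\<lambda>G. h (S \<union> insert e G)))"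
    using insert.hyps by simp
  \<comment> \<open>As \<open>e\<close> is not in \<open>S\<close>, its membership in
    \<open>G\<close> equals its membership in \<open>S \<union> G\<close>; the integrand becomes a
    function of the planted graph, as the induction hypothesis requires.\<close>
  also have "\<dots> = p ^ card S * ?E (\<lambda>G. h (S \<union> G) * of_bool (e \<in> S \<union> G))"
    using insert.prems insert.hyps expectation_plant_edge[OF p, of e n "\<lambda>G. h (S \<union> G)"] by simp
  also have "\<dots> = ?E (\<lambda>G. (h G * of_bool (e \<in> G)) * of_bool (S \<subseteq> G))"
    using insert.prems by (intro insert.IH) simp
  also have "\<dots> = ?E (\<lambda>G. h G * of_bool (insert e S \<subseteq> G))"
    by (intro Bochner_Integration.integral_cong) auto
  finally show ?case .
qed simp

lemma prob_subgraph_erdos_renyi: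
  assumes "0 \<le> p" "p \<le> 1" "S \<subseteq> complete_graph n"
  shows "measure_pmf.expectation (erdos_renyi n p) (\<lambda>G. of_bool (S \<subseteq> G)) = p ^ card S"
  using expectation_plant[OF assms, of "\<lambda>_. 1"] by simp

lemma expectation_planted_model:
  fixes h :: "graph \<times> graph \<Rightarrow> real"
  assumes T: "T \<subseteq> complete_graph n"
  shows "measure_pmf.expectation (planted_model n T p) h =
    (\<Sum>T'\<in>copies n T. measure_pmf.expectation (erdos_renyi n p) (\<lambda>G. h (T', G))) /
      real (card (copies n T))"
proof -
  have "planted_model n T p = pmf_of_set (copies n T) \<bind> (\<lambda>T'. map_pmf (Pair T') (erdos_renyi n p))"
    by (simp add: planted_model_def pair_pmf_def map_pmf_def)
  moreover have "copies n T \<noteq> {}" using self_mem_copies by blast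
  ultimately show ?thesis
    using finite_copies[OF T]
    by (simp add: pmf_expectation_bind_pmf_of_set finite_set_erdos_renyi sum_divide_distrib
        divide_inverse mult.commute sum_distrib_left)
qed

lemma finite_set_planted_model:
  assumes "T \<subseteq> complete_graph n"
  shows "finite (set_pmf (planted_model n T p))"
proof -
  have "copies n T \<noteq> {}" using self_mem_copies by blast
  then show ?thesis
    using finite_copies[OF assms] by (simp add: planted_model_def finite_set_erdos_renyi)
qed

lemma integrable_planted_model:
  fixes f :: "graph \<times> graph \<Rightarrow> real"
  shows "T \<subseteq> complete_graph n \<Longrightarrow> integrable (measure_pmf (planted_model n T p)) f"
  by (rule integrable_measure_pmf_finite[OF finite_set_planted_model])

definition copies_in :: "nat \<Rightarrow> graph \<Rightarrow> graph \<Rightarrow> graph set" where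
  "copies_in n T G = {T' \<in> copies n T. T' \<subseteq> G}"

lemma finite_copies_in: "T \<subseteq> complete_graph n \<Longrightarrow> finite (copies_in n T G)"
  by (simp add: copies_in_def finite_copies)

text \<open>Bayes' rule, unnormalised: relative to pure noise, every copy inside \<open>G\<close>
  carries the same weight. The denominator is the mean number of copies in noise, so with X copies
  in \<open>G\<close> the observation has density X / E X, and the planted copy is uniform on
  \<open>copies_in n T G\<close>.\<close>

lemma expectation_planted_eq_erdos_renyi:
  fixes h :: "graph \<Rightarrow> graph \<Rightarrow> real"
  assumes p: "0 < p" "p \<le> 1" and T: "T \<subseteq> complete_graph n"
  shows "measure_pmf.expectation (planted_model n T p) (\<lambda>\<omega>. h (fst \<omega>) (observation \<omega>)) =
    measure_pmf.expectation (erdos_renyi n p) (\<lambda>G. \<Sum>T'\<in>copies_in n T G. h T' G) /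
      (real (card (copies n T)) * p ^ card T)"
proof -
  let ?E = "measure_pmf.expectation (erdos_renyi n p)"
  have "p ^ card T * ?E (\<lambda>G. h T' (T' \<union> G)) = ?E (\<lambda>G. h T' G * of_bool (T' \<subseteq> G))"
    if "T' \<in> copies n T" for T'
    using expectation_plant[OF less_imp_le[OF p(1)] p(2) copies_subset_complete_graph[OF T that]]
      card_copy[OF that] by simp
  then have "p ^ card T * (\<Sum>T'\<in>copies n T. ?E (\<lambda>G. h T' (T' \<union> G))) =
      (\<Sum>T'\<in>copies n T. ?E (\<lambda>G. h T' G * of_bool (T' \<subseteq> G)))"
    by (simp add: sum_distrib_left)
  also have "\<dots> = ?E (\<lambda>G. \<Sum>T'\<in>copies n T. h T' G * of_bool (T' \<subseteq> G))"
    by (simp add: Bochner_Integration.integral_sum)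
  also have "(\<lambda>G. \<Sum>T'\<in>copies n T. h T' G * of_bool (T' \<subseteq> G)) = (\<lambda>G. \<Sum>T'\<in>copies_in n T G. h T' G)"
    unfolding copies_in_def sum.inter_filter[OF finite_copies[OF T]]
    by (intro ext sum.cong) auto
  finally have eq: "p ^ card T * (\<Sum>T'\<in>copies n T. ?E (\<lambda>G. h T' (T' \<union> G))) =
      ?E (\<lambda>G. \<Sum>T'\<in>copies_in n T G. h T' G)" .
  show ?thesis
    unfolding expectation_planted_model[OF T] eq[symmetric]
    using p by (simp add: observation_def)
qed

section \<open>The posterior mean and the MMSE\<close>

text \<open>For \<open>G\<close> without copies the value is 0 / 0 = 0; such a \<open>G\<close> is
  never observed, because the observation contains the planted copy.\<close>

definition posterior :: "nat \<Rightarrow> graph \<Rightarrow> nat set \<Rightarrow> graph \<Rightarrow> real" where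
  "posterior n T e G = real (card {T'\<in>copies_in n T G. e \<in> T'}) / real (card (copies_in n T G))"

lemma sum_copies_in_indicator:
  assumes "T \<subseteq> complete_graph n"
  shows "(\<Sum>T'\<in>copies_in n T G. of_bool (e \<in> T')) = real (card {T'\<in>copies_in n T G. e \<in> T'})"
proof -
  have "copies_in n T G \<inter> {T'. e \<in> T'} = {T'\<in>copies_in n T G. e \<in> T'}" by blast
  then show ?thesis using finite_copies_in[OF assms, of G] by simp
qed

text \<open>With \<open>sum_copies_in_indicator\<close> this gives the edge indicator and the
  posterior equal sums over the copies in each \<open>G\<close>: the orthogonality behind both the
  conditional expectation and its optimality.\<close>

lemma sum_copies_in_posterior:
  assumes "T \<subseteq> complete_graph n"
  shows "(\<Sum>T'\<in>copies_in n T G. posterior n T e G) = real (card {T'\<in>copies_in n T G. e \<in> T'})"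
  using finite_copies_in[OF assms, of G]
  by (cases "copies_in n T G = {}") (auto simp: posterior_def)

lemma real_cond_exp_edge_indicator:
  assumes p: "0 < p" "p \<le> 1" and T: "T \<subseteq> complete_graph n"
  shows "AE \<omega> in measure_pmf (planted_model n T p).
    real_cond_exp (measure_pmf (planted_model n T p)) observation_algebra (edge_indicator e) \<omega> =
      posterior n T e (observation \<omega>)"
proof -
  let ?M = "measure_pmf (planted_model n T p)"
  have sub: "subalgebra ?M observation_algebra"
    by (simp add: subalgebra_def observation_algebra_def)
  interpret finite_measure_subalgebra ?M observation_algebra
    by unfold_locales (use sub in auto)
  show ?thesis
  proof (rule real_cond_exp_charact)
    fix A assume "A \<in> sets observation_algebra"
    then obtain B where A: "A = observation -` B"
      by (auto simp: observation_algebra_def sets_vimage_algebra2)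
    have i: "indicator A \<omega> = (indicator B (observation \<omega>) :: real)" for \<omega>
      by (simp add: A indicator_def)
    have "(\<integral>\<omega>\<in>A. edge_indicator e \<omega> \<partial>?M) =
        measure_pmf.expectation (planted_model n T p)
          (\<lambda>\<omega>. indicator B (observation \<omega>) * of_bool (e \<in> fst \<omega>))"
      unfolding set_lebesgue_integral_def
      by (intro Bochner_Integration.integral_cong) (auto simp: i edge_indicator_def)
    also have "\<dots> = measure_pmf.expectation (planted_model n T p)
          (\<lambda>\<omega>. indicator B (observation \<omega>) * posterior n T e (observation \<omega>))"
      unfolding expectation_planted_eq_erdos_renyi[OF p T, of "\<lambda>T' G. indicator B G * of_bool (e \<in> T')"]
        expectation_planted_eq_erdos_renyi[OF p T, of "\<lambda>T' G. indicator B G * posterior n T e G"]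
        sum_distrib_left[symmetric] sum_copies_in_indicator[OF T] sum_copies_in_posterior[OF T] ..
    also have "\<dots> = (\<integral>\<omega>\<in>A. posterior n T e (observation \<omega>) \<partial>?M)"
      unfolding set_lebesgue_integral_def by (simp add: i)
    finally show "(\<integral>\<omega>\<in>A. edge_indicator e \<omega> \<partial>?M) =
      (\<integral>\<omega>\<in>A. posterior n T e (observation \<omega>) \<partial>?M)" .
  next
    show "(\<lambda>\<omega>. posterior n T e (observation \<omega>)) \<in> borel_measurable observation_algebra"
      unfolding observation_algebra_def
      by (rule measurable_compose[OF measurable_vimage_algebra1]) auto
  qed (use integrable_planted_model[OF T] in auto)
qed

lemma mmse_eq_posterior:
  assumes p: "0 < p" "p \<le> 1" and T: "T \<subseteq> complete_graph n"
  shows "mmse n T p = measure_pmf.expectation (erdos_renyi n p)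
      (\<lambda>G. \<Sum>T'\<in>copies_in n T G. \<Sum>e\<in>complete_graph n. (of_bool (e \<in> T') - posterior n T e G)\<^sup>2) /
      (real (card (copies n T)) * p ^ card T) / real (card T)"
proof -
  let ?M = "planted_model n T p"
  \<comment> \<open>\<open>real_cond_exp\<close> is only determined almost surely; the finitely many
    edges share one null set.\<close>
  have "AE \<omega> in measure_pmf ?M. \<forall>e\<in>complete_graph n.
      real_cond_exp (measure_pmf ?M) observation_algebra (edge_indicator e) \<omega> =
        posterior n T e (observation \<omega>)"
    using real_cond_exp_edge_indicator[OF assms]
    by (intro AE_finite_allI finite_complete_graph)
  then have "measure_pmf.expectation ?M (\<lambda>\<omega>. \<Sum>e\<in>complete_graph n.
      (edge_indicator e \<omega> - real_cond_exp (measure_pmf ?M) observation_algebra (edge_indicator e) \<omega>)\<^sup>2) =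
    measure_pmf.expectation ?M (\<lambda>\<omega>. \<Sum>e\<in>complete_graph n.
      (of_bool (e \<in> fst \<omega>) - posterior n T e (observation \<omega>))\<^sup>2)"
    by (intro integral_cong_AE) (auto simp: edge_indicator_def elim!: eventually_mono intro!: sum.cong)
  then show ?thesis
    unfolding mmse_def
    by (simp add: expectation_planted_eq_erdos_renyi[OF p T,
        of "\<lambda>T' G. \<Sum>e\<in>complete_graph n. (of_bool (e \<in> T') - posterior n T e G)\<^sup>2"])
qed

section \<open>Finite-size bounds on the MMSE\<close>

lemma sum_complete_graph_indicator:
  "S \<subseteq> complete_graph n \<Longrightarrow> (\<Sum>e\<in>complete_graph n. of_bool (e \<in> S)) = real (card S)"
  using finite_complete_graph[of n] by (simp add: Int_absorb1)

lemma expectation_card_copies_in: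
  assumes p: "0 < p" "p \<le> 1" and T: "T \<subseteq> complete_graph n"
  shows "measure_pmf.expectation (erdos_renyi n p) (\<lambda>G. real (card (copies_in n T G))) =
    real (card (copies n T)) * p ^ card T"
  using expectation_planted_eq_erdos_renyi[OF assms, of "\<lambda>_ _. 1"] card_copies_pos[OF T] p
  by (simp add: field_simps)

section \<open>Lower bound on the MMSE above the threshold\<close>

text \<open>An edge contained in A of the copies contributes A - A^2 / |C|, a variance. Over all
  edges the terms A add up to |C| |T|, and the terms A^2 count pairs of copies with their common
  edges.\<close>

lemma posterior_loss_eq:
  fixes G :: graph
  assumes T: "T \<subseteq> complete_graph n"
  defines "C \<equiv> copies_in n T G"
  shows "(\<Sum>T'\<in>C. \<Sum>e\<in>complete_graph n. (of_bool (e \<in> T') - posterior n T e G)\<^sup>2) =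
    real (card C) * real (card T) - (\<Sum>T'\<in>C. \<Sum>T''\<in>C. real (card (T' \<inter> T''))) / real (card C)"
proof -
  let ?K = "complete_graph n"
  define A where "A e = real (card {T'\<in>C. e \<in> T'})" for e
  have A: "(\<Sum>T'\<in>C. of_bool (e \<in> T')) = A e" for e
    unfolding A_def C_def by (rule sum_copies_in_indicator[OF T])
  have sub: "T' \<subseteq> ?K" "card T' = card T" if "T' \<in> C" for T'
    using that copies_subset_complete_graph[OF T] card_copy by (auto simp: C_def copies_in_def)
  have "(\<Sum>T'\<in>C. (of_bool (e \<in> T') - posterior n T e G)\<^sup>2) = A e - (A e)\<^sup>2 / real (card C)" for e
  proof -
    let ?\<pi> = "posterior n T e G"
    have "(\<Sum>T'\<in>C. (of_bool (e \<in> T') - ?\<pi>)\<^sup>2) =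
        (\<Sum>T'\<in>C. of_bool (e \<in> T') - 2 * ?\<pi> * of_bool (e \<in> T') + ?\<pi>\<^sup>2)"
      by (intro sum.cong refl) (auto simp: power2_eq_square algebra_simps)
    also have "\<dots> = A e - 2 * ?\<pi> * A e + real (card C) * ?\<pi>\<^sup>2"
      by (simp add: sum.distrib sum_subtractf sum_distrib_left[symmetric] A)
    also have "\<dots> = A e - (A e)\<^sup>2 / real (card C)"
      unfolding posterior_def C_def[symmetric] A_def[symmetric]
      by (cases "card C = 0") (auto simp: field_simps power2_eq_square)
    finally show ?thesis .
  qed
  then have "(\<Sum>T'\<in>C. \<Sum>e\<in>?K. (of_bool (e \<in> T') - posterior n T e G)\<^sup>2) =
      (\<Sum>e\<in>?K. A e) - (\<Sum>e\<in>?K. (A e)\<^sup>2) / real (card C)"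
    by (subst sum.swap) (simp add: sum_subtractf sum_divide_distrib)
  moreover have "(\<Sum>e\<in>?K. A e) = real (card C) * real (card T)"
  proof -
    have "(\<Sum>e\<in>?K. A e) = (\<Sum>T'\<in>C. \<Sum>e\<in>?K. of_bool (e \<in> T'))"
      unfolding A[symmetric] by (rule sum.swap)
    also have "\<dots> = (\<Sum>T'\<in>C. real (card T))"
      using sub by (intro sum.cong refl) (simp only: sum_complete_graph_indicator)
    finally show ?thesis by simp
  qed
  moreover have "(\<Sum>e\<in>?K. (A e)\<^sup>2) = (\<Sum>T'\<in>C. \<Sum>T''\<in>C. real (card (T' \<inter> T'')))"
  proof -
    have "(\<Sum>e\<in>?K. (A e)\<^sup>2) = (\<Sum>e\<in>?K. \<Sum>T'\<in>C. \<Sum>T''\<in>C. of_bool (e \<in> T' \<inter> T''))"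
      unfolding A[symmetric] power2_eq_square sum_product by (intro sum.cong refl) auto
    also have "\<dots> = (\<Sum>T'\<in>C. \<Sum>e\<in>?K. \<Sum>T''\<in>C. of_bool (e \<in> T' \<inter> T''))"
      by (rule sum.swap)
    also have "\<dots> = (\<Sum>T'\<in>C. \<Sum>T''\<in>C. \<Sum>e\<in>?K. of_bool (e \<in> T' \<inter> T''))"
      by (intro sum.cong refl sum.swap)
    also have "\<dots> = (\<Sum>T'\<in>C. \<Sum>T''\<in>C. real (card (T' \<inter> T'')))"
    proof (intro sum.cong refl)
      fix T' T'' assume "T' \<in> C"
      then have "T' \<inter> T'' \<subseteq> ?K" using sub(1) by blast
      then show "(\<Sum>e\<in>?K. of_bool (e \<in> T' \<inter> T'')) = real (card (T' \<inter> T''))"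
        by (rule sum_complete_graph_indicator)
    qed
    finally show ?thesis .
  qed
  ultimately show ?thesis by simp
qed

definition overlapping_pairs :: "nat \<Rightarrow> graph \<Rightarrow> real \<Rightarrow> graph \<Rightarrow> real" where
  "overlapping_pairs n T a G =
     (\<Sum>T'\<in>copies_in n T G. \<Sum>T''\<in>copies_in n T G. of_bool (a \<le> real (card (T' \<inter> T''))))"

text \<open>Splitting at \<open>card (copies_in n T G) = a\<close> bounds the posterior average of an indicator
  without any concentration of the number of copies.\<close>

lemma posterior_loss_ge:
  fixes G :: graph
  assumes T: "T \<subseteq> complete_graph n" and a: "0 < a" and \<eta>: "0 \<le> \<eta>"
  defines "C \<equiv> copies_in n T G"
  shows "(\<Sum>T'\<in>C. \<Sum>e\<in>complete_graph n. (of_bool (e \<in> T') - posterior n T e G)\<^sup>2) \<ge>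
    real (card T) * ((1 - \<eta>) * real (card C) - a - overlapping_pairs n T (\<eta> * real (card T)) G / a)"
proof -
  define X where "X = real (card C)"
  define m where "m = real (card T)"
  define Y where "Y = overlapping_pairs n T (\<eta> * m) G"
  have m: "0 \<le> m" and X: "0 \<le> X" by (auto simp: m_def X_def)
  have Y0: "0 \<le> Y" unfolding Y_def overlapping_pairs_def by (intro sum_nonneg) auto
  \<comment> \<open>The trivial bound on the number of pairs, which handles the case of at most
    \<open>a\<close> copies.\<close>
  have YX: "Y \<le> X * X"
  proof -
    have "Y \<le> (\<Sum>T'\<in>C. \<Sum>T''\<in>C. 1)"
      unfolding Y_def overlapping_pairs_def C_def by (intro sum_mono) auto
    then show ?thesis by (simp add: X_def)
  qed
  define S where "S = (\<Sum>T'\<in>C. \<Sum>T''\<in>C. real (card (T' \<inter> T'')))"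
  \<comment> \<open>An overlap below \<open>\<eta> * m\<close> costs at most
    \<open>\<eta> * m\<close>; any other costs at most \<open>m\<close>, the size of one
    copy.\<close>
  have "S \<le>
      (\<Sum>T'\<in>C. \<Sum>T''\<in>C. \<eta> * m + m * of_bool (\<eta> * m \<le> real (card (T' \<inter> T''))))"
    unfolding S_def
  proof (intro sum_mono)
    fix T' T'' assume "T' \<in> C"
    then have T': "T' \<in> copies n T" by (simp add: C_def copies_in_def)
    have "finite T'" by (rule finite_subgraph[OF copies_subset_complete_graph[OF T T']])
    then have "card (T' \<inter> T'') \<le> card T" using card_copy[OF T'] card_mono[of T' "T' \<inter> T''"] by simp
    moreover have "0 \<le> \<eta> * m" using \<eta> m by simp
    ultimately show "real (card (T' \<inter> T'')) \<le> \<eta> * m + m * of_bool (\<eta> * m \<le> real (card (T' \<inter> T'')))"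
      by (auto simp: m_def)
  qed
  also have "\<dots> = X * (X * (\<eta> * m)) + m * Y"
    by (simp add: sum.distrib Y_def overlapping_pairs_def C_def[symmetric] X_def sum_distrib_left)
  finally have "S / X \<le> (X * (X * (\<eta> * m)) + m * Y) / X"
    using X by (rule divide_right_mono)
  also have "\<dots> = X * \<eta> * m + m * (Y / X)"
    by (cases "X = 0") (auto simp: field_simps)
  also have "\<dots> \<le> X * \<eta> * m + m * (a + Y / a)"
  proof -
    have "Y / X \<le> a + Y / a"
    proof (cases "X \<le> a")
      case True
      have "Y / X \<le> X"
        using YX X by (cases "X = 0") (auto simp: field_simps)
      moreover have "0 \<le> Y / a" using Y0 a by simp
      ultimately show ?thesis using True by linarith
    next
      case False
      then have "Y / X \<le> Y / a" using Y0 a by (intro divide_left_mono) auto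
      then show ?thesis using a by simp
    qed
    then show ?thesis using m by (intro add_left_mono mult_left_mono)
  qed
  finally have SX: "S / X \<le> X * \<eta> * m + m * (a + Y / a)" .
  have eq: "(\<Sum>T'\<in>C. \<Sum>e\<in>complete_graph n. (of_bool (e \<in> T') - posterior n T e G)\<^sup>2) = X * m - S / X"
    unfolding X_def m_def S_def C_def by (rule posterior_loss_eq[OF T])
  have "m * ((1 - \<eta>) * X - a - Y / a) = X * m - (X * \<eta> * m + m * (a + Y / a))"
    by (simp add: algebra_simps)
  also have "\<dots> \<le> X * m - S / X" using SX by simp
  finally show ?thesis unfolding eq X_def m_def Y_def .
qed

lemma expectation_overlapping_pairs:
  assumes p: "0 \<le> p" "p \<le> 1" and T: "T \<subseteq> complete_graph n"
  shows "measure_pmf.expectation (erdos_renyi n p) (overlapping_pairs n T a) =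
    (\<Sum>T'\<in>copies n T. \<Sum>T''\<in>copies n T.
      of_bool (a \<le> real (card (T' \<inter> T''))) * p ^ card (T' \<union> T''))"
proof -
  let ?E = "measure_pmf.expectation (erdos_renyi n p)"
  have eq: "overlapping_pairs n T a = (\<lambda>G. \<Sum>T'\<in>copies n T. \<Sum>T''\<in>copies n T.
      of_bool (a \<le> real (card (T' \<inter> T''))) * of_bool (T' \<union> T'' \<subseteq> G))"
  proof
    fix G
    have "overlapping_pairs n T a G = (\<Sum>T'\<in>copies n T. if T' \<subseteq> G then
        \<Sum>T''\<in>copies n T. if T'' \<subseteq> G then of_bool (a \<le> real (card (T' \<inter> T''))) else 0 else 0)"
      unfolding overlapping_pairs_def copies_in_def sum.inter_filter[OF finite_copies[OF T]] ..
    also have "\<dots> = (\<Sum>T'\<in>copies n T. \<Sum>T''\<in>copies n T.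
      of_bool (a \<le> real (card (T' \<inter> T''))) * of_bool (T' \<union> T'' \<subseteq> G))"
      by (intro sum.cong refl) (auto intro!: sum.cong)
    finally show "overlapping_pairs n T a G = (\<Sum>T'\<in>copies n T. \<Sum>T''\<in>copies n T.
      of_bool (a \<le> real (card (T' \<inter> T''))) * of_bool (T' \<union> T'' \<subseteq> G))" .
  qed
  have "?E (overlapping_pairs n T a) = (\<Sum>T'\<in>copies n T. \<Sum>T''\<in>copies n T.
      of_bool (a \<le> real (card (T' \<inter> T''))) * ?E (\<lambda>G. of_bool (T' \<union> T'' \<subseteq> G)))"
    unfolding eq by (simp add: Bochner_Integration.integral_sum del: Un_subset_iff)
  also have "\<dots> = (\<Sum>T'\<in>copies n T. \<Sum>T''\<in>copies n T.
      of_bool (a \<le> real (card (T' \<inter> T''))) * p ^ card (T' \<union> T''))"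
    using copies_subset_complete_graph[OF T]
    by (intro sum.cong refl arg_cong2[where f = "(*)"] prob_subgraph_erdos_renyi[OF p]) auto
  finally show ?thesis .
qed

text \<open>With q = n^(-1/d), a graph with l edges on k vertices and density at most d has n^k q^l
  >= 1, because l / d <= k.\<close>

lemma threshold_power_ge:
  assumes n: "1 \<le> n" and d: "0 < d" and l: "real l \<le> d * real k"
  shows "(1 / real n) ^ k \<le> (real n powr (- 1 / d)) ^ l"
proof -
  have "(1 / real n) ^ k = real n powr (- real k)"
    using n by (simp add: powr_minus powr_realpow power_one_over inverse_eq_divide)
  also have "\<dots> \<le> real n powr (- 1 / d * real l)"
    using n d l by (intro powr_mono) (auto simp: field_simps)
  also have "\<dots> = (real n powr (- 1 / d)) ^ l"
    using n by (simp add: powr_power)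
  finally show ?thesis .
qed

text \<open>The common edges form a subgraph of \<open>T\<close>, and their endpoints are vertices
  of both graphs.\<close>

lemma card_Int_le_density:
  assumes T: "T \<subseteq> complete_graph n" "density_le T d" "0 \<le> d"
  shows "real (card (T \<inter> S)) \<le> d * real (card (\<Union>T \<inter> \<Union>S))"
proof -
  have "real (card (T \<inter> S)) \<le> d * real (num_verts (T \<inter> S))"
    using T(2) by (simp add: density_le_def)
  also have "\<dots> \<le> d * real (card (\<Union>T \<inter> \<Union>S))"
    using finite_Union_subgraph[OF T(1)] T(3)
    by (intro mult_left_mono) (auto simp: num_verts_def intro!: card_mono)
  finally show ?thesis .
qed

text \<open>Averages \<open>posterior_loss_ge\<close> over the noise with \<open>a\<close> equal to
  \<open>t\<close> times the mean number of copies. The three losses come from small overlaps, from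
  having few copies, and from pairs with large overlap.\<close>

lemma mmse_ge:
  fixes \<eta> \<delta> t d p :: real
  assumes T: "T \<subseteq> complete_graph n" "T \<noteq> {}" and n: "1 \<le> n"
    and d: "0 < d" "density_le T d"
    and p: "(1 + \<delta>) * real n powr (- 1 / d) \<le> p" "p \<le> 1"
    and pos: "0 \<le> \<delta>" "0 < t" "0 \<le> \<eta>"
  defines "v \<equiv> real (num_verts T)"
  shows "1 - \<eta> - t - (v * (v + 1)) ^ num_verts T * (1 + \<delta>) powr (- (\<eta> * real (card T))) / t
    \<le> mmse n T p"
proof -
  define q where "q = real n powr (- 1 / d)"
  define m where "m = card T"
  define C where "C = copies n T"
  \<comment> \<open>The mean number of copies of \<open>T\<close> in pure noise.\<close>
  define \<mu> where "\<mu> = real (card C) * p ^ m"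
  define B where "B = (v * (v + 1)) ^ num_verts T"
  define D where "D = (1 + \<delta>) powr (- (\<eta> * real m))"
  let ?E = "measure_pmf.expectation (erdos_renyi n p)"
  let ?Y = "overlapping_pairs n T (\<eta> * real m)"
  have q0: "0 < q" using n by (simp add: q_def)
  have p0: "0 < p" using p(1) q0 pos by (intro less_le_trans[OF _ p(1)]) (simp add: q_def)
  have m0: "0 < m" using T finite_subgraph by (simp add: m_def card_gt_0_iff)
  have N0: "0 < card C" unfolding C_def by (rule card_copies_pos[OF T(1)])
  have \<mu>0: "0 < \<mu>" using N0 p0 by (simp add: \<mu>_def)
  have D0: "0 \<le> D" by (simp add: D_def)
  \<comment> \<open>With l common edges the union has 2m - l edges, which leaves p^(-l) beside
    p^(2m). By \<open>p \<ge> (1 + \<delta>) * q\<close> this is at most (1+\<delta>)^(-l) q^(-l):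
    the first factor is at most \<open>D\<close> since l >= \<eta> m, the second at most n to the
    number of common vertices by the density bound.\<close>
  have pair: "of_bool (\<eta> * real m \<le> real (card (T' \<inter> T''))) * p ^ card (T' \<union> T'') \<le>
      p ^ m * p ^ m * D * real n ^ card (\<Union>T' \<inter> \<Union>T'')"
    if T': "T' \<in> C" and T'': "T'' \<in> C" for T' T''
  proof (cases "\<eta> * real m \<le> real (card (T' \<inter> T''))")
    case True
    define l where "l = card (T' \<inter> T'')"
    have sub: "T' \<subseteq> complete_graph n" "T'' \<subseteq> complete_graph n"
      using T' T'' copies_subset_complete_graph[OF T(1)] by (auto simp: C_def)
    have c: "card T' = m" "card T'' = m" using T' T'' card_copy by (auto simp: C_def m_def)
    have "card (T' \<union> T'') + l = m + m"
      using card_Un_Int[of T' T''] finite_subgraph sub c by (simp add: l_def)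
    then have "p ^ card (T' \<union> T'') * p ^ l = p ^ m * p ^ m" by (simp flip: power_add)
    then have *: "p ^ card (T' \<union> T'') = p ^ m * p ^ m * (1 / p ^ l)" using p0 by (simp add: field_simps)
    have "density_le T' d" using density_le_copy[OF d(2)] T' by (simp add: C_def)
    then have "real l \<le> d * real (card (\<Union>T' \<inter> \<Union>T''))"
      unfolding l_def using card_Int_le_density sub(1) d(1) by simp
    then have "(1 / real n) ^ card (\<Union>T' \<inter> \<Union>T'') \<le> q ^ l"
      unfolding q_def by (rule threshold_power_ge[OF n d(1)])
    then have ql: "1 / q ^ l \<le> real n ^ card (\<Union>T' \<inter> \<Union>T'')"
      using n q0 by (simp add: field_simps power_one_over)
    have "1 / (1 + \<delta>) ^ l = (1 + \<delta>) powr (- real l)"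
      using pos(1) by (simp add: powr_minus powr_realpow inverse_eq_divide)
    also have "\<dots> \<le> D" unfolding D_def using True pos(1) by (intro powr_mono) (auto simp: l_def)
    finally have dl: "1 / (1 + \<delta>) ^ l \<le> D" .
    have "1 / p ^ l \<le> 1 / ((1 + \<delta>) * q) ^ l"
      using p(1) q0 pos(1) p0 unfolding q_def[symmetric]
      by (intro divide_left_mono power_mono) auto
    also have "\<dots> = (1 / (1 + \<delta>) ^ l) * (1 / q ^ l)" by (simp add: power_mult_distrib)
    also have "\<dots> \<le> D * real n ^ card (\<Union>T' \<inter> \<Union>T'')"
      using dl ql D0 q0 by (intro mult_mono) auto
    finally have "p ^ m * p ^ m * (1 / p ^ l) \<le> p ^ m * p ^ m * (D * real n ^ card (\<Union>T' \<inter> \<Union>T''))"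
      using p0 by (intro mult_left_mono) auto
    then show ?thesis using True * by (simp add: mult.assoc)
  qed (use p0 D0 in auto)
  have "?E ?Y \<le> (\<Sum>T'\<in>C. \<Sum>T''\<in>C. p ^ m * p ^ m * D * real n ^ card (\<Union>T' \<inter> \<Union>T''))"
    unfolding expectation_overlapping_pairs[OF less_imp_le[OF p0] p(2) T(1)] C_def[symmetric]
    by (intro sum_mono pair)
  also have "\<dots> = p ^ m * p ^ m * D * (\<Sum>T'\<in>C. \<Sum>T''\<in>C. real n ^ card (\<Union>T' \<inter> \<Union>T''))"
    by (simp add: sum_distrib_left)
  also have "\<dots> \<le> p ^ m * p ^ m * D * (\<Sum>T'\<in>C. real (card C) * B)"
  proof (intro mult_left_mono sum_mono)
    fix T' assume "T' \<in> C"
    then have T': "T' \<in> copies n T" by (simp add: C_def)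
    show "(\<Sum>T''\<in>C. real n ^ card (\<Union>T' \<inter> \<Union>T'')) \<le> real (card C) * B"
      unfolding C_def B_def v_def
    proof (rule sum_copies_pow_overlap_le[OF T(1) n])
      show "\<Union>T' \<subseteq> {1..n}"
        by (rule Union_subset_vertices[OF copies_subset_complete_graph[OF T(1) T']])
      show "card (\<Union>T') = num_verts T" using num_verts_copy[OF T'] by (simp add: num_verts_def)
    qed
  qed (use p0 D0 in auto)
  also have "\<dots> = \<mu> * \<mu> * (B * D)" by (simp add: \<mu>_def)
  finally have EY: "?E ?Y \<le> \<mu> * \<mu> * (B * D)" .
  \<comment> \<open>The cut-off \<open>t * \<mu>\<close> scales all terms by \<open>\<mu>\<close>,
    once the pairs are bounded by \<open>EY\<close>, so \<open>\<mu>\<close> cancels in the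
    end.\<close>
  have "?E (\<lambda>G. real m * ((1 - \<eta>) * real (card (copies_in n T G)) - t * \<mu> - ?Y G / (t * \<mu>))) \<le>
      ?E (\<lambda>G. \<Sum>T'\<in>copies_in n T G. \<Sum>e\<in>complete_graph n. (of_bool (e \<in> T') - posterior n T e G)\<^sup>2)"
    using posterior_loss_ge[OF T(1), of "t * \<mu>" \<eta>] \<mu>0 pos
    by (intro integral_mono) (auto simp: m_def)
  also have "\<dots> = mmse n T p * \<mu> * real m"
    using N0 p0 m0 by (simp add: mmse_eq_posterior[OF p0 p(2) T(1)] \<mu>_def C_def m_def)
  also have "?E (\<lambda>G. real m * ((1 - \<eta>) * real (card (copies_in n T G)) - t * \<mu> - ?Y G / (t * \<mu>))) =
      real m * ((1 - \<eta>) * \<mu> - t * \<mu> - ?E ?Y / (t * \<mu>))"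
    using expectation_card_copies_in[OF p0 p(2) T(1)] by (simp add: \<mu>_def C_def m_def)
  finally have "(1 - \<eta>) * \<mu> - t * \<mu> - ?E ?Y / (t * \<mu>) \<le> mmse n T p * \<mu>"
    using m0 by (simp add: mult.commute)
  moreover have "?E ?Y / (t * \<mu>) \<le> \<mu> * \<mu> * (B * D) / (t * \<mu>)"
    using \<mu>0 pos EY by (intro divide_right_mono) auto
  moreover have "\<mu> * \<mu> * (B * D) / (t * \<mu>) = B * D / t * \<mu>"
    using \<mu>0 by simp
  ultimately have "(1 - \<eta> - t - B * D / t) * \<mu> \<le> mmse n T p * \<mu>"
    by (simp only: left_diff_distrib)
  then show ?thesis using \<mu>0 unfolding B_def D_def m_def by (simp add: mult_le_cancel_right)
qed

section \<open>Upper bound on the MMSE below the threshold\<close>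

text \<open>For each \<open>G\<close> the posterior mean minimises the squared error over the copies
  in \<open>G\<close>, so every estimator computed from the observation gives an upper
  bound.\<close>

lemma mmse_le_estimator:
  fixes est :: "graph \<Rightarrow> graph"
  assumes p: "0 < p" "p \<le> 1" and T: "T \<subseteq> complete_graph n"
  shows "mmse n T p \<le> measure_pmf.expectation (planted_model n T p)
    (\<lambda>\<omega>. \<Sum>e\<in>complete_graph n. (of_bool (e \<in> fst \<omega>) - of_bool (e \<in> est (observation \<omega>)))\<^sup>2) / real (card T)"
proof -
  let ?K = "complete_graph n"
  have *: "(\<Sum>T'\<in>copies_in n T G. (of_bool (e \<in> T') - posterior n T e G)\<^sup>2) \<le>
      (\<Sum>T'\<in>copies_in n T G. (of_bool (e \<in> T') - a)\<^sup>2)" for e G and a :: real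
  proof -
    let ?C = "copies_in n T G" and ?\<pi> = "posterior n T e G"
    have "(\<Sum>T'\<in>?C. (of_bool (e \<in> T') - a)\<^sup>2) = (\<Sum>T'\<in>?C. (of_bool (e \<in> T') - ?\<pi>)\<^sup>2 +
        2 * (?\<pi> - a) * (of_bool (e \<in> T') - ?\<pi>) + (?\<pi> - a)\<^sup>2)"
      by (intro sum.cong refl) (simp add: power2_eq_square algebra_simps)
    also have "\<dots> = (\<Sum>T'\<in>?C. (of_bool (e \<in> T') - ?\<pi>)\<^sup>2) +
        2 * (?\<pi> - a) * (\<Sum>T'\<in>?C. of_bool (e \<in> T') - ?\<pi>) + (\<Sum>T'\<in>?C. (?\<pi> - a)\<^sup>2)"
      by (simp only: sum.distrib sum_distrib_left)
    \<comment> \<open>The cross term vanishes by orthogonality, leaving a sum of squares.\<close>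
    also have "(\<Sum>T'\<in>?C. of_bool (e \<in> T') - ?\<pi>) = 0"
      by (simp only: sum_subtractf sum_copies_in_indicator[OF T] sum_copies_in_posterior[OF T] diff_self)
    finally show ?thesis by (simp add: sum_nonneg)
  qed
  have "mmse n T p \<le> measure_pmf.expectation (erdos_renyi n p)
      (\<lambda>G. \<Sum>T'\<in>copies_in n T G. \<Sum>e\<in>?K. (of_bool (e \<in> T') - of_bool (e \<in> est G))\<^sup>2) /
      (real (card (copies n T)) * p ^ card T) / real (card T)"
    unfolding mmse_eq_posterior[OF assms]
  proof (intro divide_right_mono integral_mono)
    fix G
    show "(\<Sum>T'\<in>copies_in n T G. \<Sum>e\<in>?K. (of_bool (e \<in> T') - posterior n T e G)\<^sup>2) \<le>
      (\<Sum>T'\<in>copies_in n T G. \<Sum>e\<in>?K. (of_bool (e \<in> T') - of_bool (e \<in> est G))\<^sup>2)"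
      by (subst (1 2) sum.swap) (intro sum_mono *)
  qed (use p in auto)
  then show ?thesis
    by (simp add: expectation_planted_eq_erdos_renyi[OF assms,
      of "\<lambda>T' G. \<Sum>e\<in>?K. (of_bool (e \<in> T') - of_bool (e \<in> est G))\<^sup>2"])
qed

lemma sum_sq_diff_indicator:
  assumes "S \<subseteq> complete_graph n" "S' \<subseteq> complete_graph n"
  shows "(\<Sum>e\<in>complete_graph n. (of_bool (e \<in> S) - of_bool (e \<in> S'))\<^sup>2) =
    real (card S) + real (card S') - 2 * real (card (S \<inter> S'))"
proof -
  have "(\<Sum>e\<in>complete_graph n. (of_bool (e \<in> S) - of_bool (e \<in> S'))\<^sup>2) =
      (\<Sum>e\<in>complete_graph n. of_bool (e \<in> S) + of_bool (e \<in> S') - 2 * of_bool (e \<in> S \<inter> S') :: real)"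
    by (intro sum.cong refl) auto
  also have "\<dots> = (\<Sum>e\<in>complete_graph n. of_bool (e \<in> S)) + (\<Sum>e\<in>complete_graph n. of_bool (e \<in> S')) -
      2 * (\<Sum>e\<in>complete_graph n. of_bool (e \<in> S \<inter> S'))"
    by (simp only: sum.distrib sum_subtractf sum_distrib_left)
  also have "\<dots> = real (card S) + real (card S') - 2 * real (card (S \<inter> S'))"
  proof -
    have "S \<inter> S' \<subseteq> complete_graph n" using assms by blast
    then show ?thesis using assms by (simp only: sum_complete_graph_indicator)
  qed
  finally show ?thesis .
qed

definition spurious_copy :: "nat \<Rightarrow> graph \<Rightarrow> real \<Rightarrow> graph \<Rightarrow> graph \<Rightarrow> bool" where
  "spurious_copy n J a T' G \<longleftrightarrow> (\<exists>J'\<in>copies_in n J G. real (card (T' \<inter> J')) < a)"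

text \<open>Union bound over the copies of \<open>J\<close>. A copy meeting \<open>T\<close> in k
  vertices shares at most d k edges with it; as \<open>J\<close> has density exactly d, at least d
  (v(J) - k) edges must come from noise. They supply the factor n^(-(v(J) - k)) needed by
  \<open>sum_copies_missing_le\<close>, and the at least \<eta> |J| missing edges supply the power
  of 1 - \<delta>.\<close>

lemma prob_spurious_copy_le:
  fixes \<eta> \<delta> d :: real
  assumes T: "T \<subseteq> complete_graph n" and J: "J \<subseteq> complete_graph n" and n: "1 \<le> n"
    and d: "0 < d" "density_le T d" "real (card J) = d * real (num_verts J)"
    and \<delta>: "0 < \<delta>" "\<delta> < 1"
  defines "p \<equiv> (1 - \<delta>) * real n powr (- 1 / d)"
  shows "measure_pmf.expectation (erdos_renyi n p)
      (\<lambda>G. of_bool (spurious_copy n J ((1 - \<eta>) * real (card J)) T (T \<union> G))) \<le>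
    (1 - \<delta>) powr (\<eta> * real (card J)) * (real (num_verts T) + 1) ^ num_verts J"
proof -
  let ?E = "measure_pmf.expectation (erdos_renyi n p) :: (graph \<Rightarrow> real) \<Rightarrow> real"
  define q where "q = real n powr (- 1 / d)"
  define a where "a = (1 - \<eta>) * real (card J)"
  define D where "D = (1 - \<delta>) powr (\<eta> * real (card J))"
  have q0: "0 < q" using n by (simp add: q_def)
  have q1: "q \<le> 1" using n d(1) powr_mono[of "- 1 / d" 0 "real n"] by (simp add: q_def)
  have pq: "p = (1 - \<delta>) * q" by (simp add: p_def q_def)
  have p: "0 \<le> p" "p \<le> 1" using q0 q1 \<delta> by (auto simp: pq intro!: mult_le_one)
  have D0: "0 \<le> D" by (simp add: D_def)
  have bound: "of_bool (real (card (T \<inter> J')) < a) * p ^ card (J' - T) \<le>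
      D * (1 / real n) ^ (num_verts J - card (\<Union>T \<inter> \<Union>J'))" if J': "J' \<in> copies n J" for J'
  proof (cases "real (card (T \<inter> J')) < a")
    case True
    define l where "l = card (J' - T)"
    define k where "k = card (\<Union>T \<inter> \<Union>J')"
    have sub: "J' \<subseteq> complete_graph n" by (rule copies_subset_complete_graph[OF J J'])
    have vJ: "card (\<Union>J') = num_verts J" using num_verts_copy[OF J'] by (simp add: num_verts_def)
    have kv: "k \<le> num_verts J"
      unfolding k_def vJ[symmetric] using finite_Union_subgraph[OF sub] by (intro card_mono) auto
    have "card J' = card (J' \<inter> T) + card (J' - T)"
      using finite_subgraph[OF sub] by (rule card_Int_Diff)
    then have cl: "real (card J) = real (card (T \<inter> J')) + real l"
      using card_copy[OF J'] by (simp add: l_def Int_commute)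
    have "real (card (T \<inter> J')) \<le> d * real k"
      unfolding k_def using card_Int_le_density[OF T d(2)] d(1) by simp
    then have dk: "d * real (num_verts J - k) \<le> real l"
      using cl d(3) kv by (simp add: of_nat_diff right_diff_distrib)
    have "q ^ l = real n powr (- (real l / d))"
      using n by (simp add: q_def powr_power)
    also have "\<dots> \<le> real n powr (- real (num_verts J - k))"
      using n d(1) dk by (intro powr_mono) (auto simp: field_simps)
    also have "\<dots> = (1 / real n) ^ (num_verts J - k)"
      using n by (simp add: powr_minus powr_realpow power_one_over inverse_eq_divide)
    finally have ql: "q ^ l \<le> (1 / real n) ^ (num_verts J - k)" .
    have "\<eta> * real (card J) \<le> real l"
      using True cl by (simp add: a_def algebra_simps)
    then have "(1 - \<delta>) powr real l \<le> D"
      unfolding D_def using \<delta> by (intro powr_mono') auto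
    then have "(1 - \<delta>) ^ l \<le> D" using \<delta> by (simp add: powr_realpow)
    then have "p ^ l \<le> D * (1 / real n) ^ (num_verts J - k)"
      unfolding pq power_mult_distrib using ql q0 D0 by (intro mult_mono) auto
    then show ?thesis using True by (simp add: l_def k_def)
  qed (use D0 in auto)
  \<comment> \<open>A copy lies in \<open>T \<union> G\<close> exactly when its edges outside
    \<open>T\<close> lie in the noise; existence is bounded by the sum over copies.\<close>
  have "?E (\<lambda>G. of_bool (spurious_copy n J a T (T \<union> G))) \<le>
      ?E (\<lambda>G. \<Sum>J'\<in>copies n J. of_bool (real (card (T \<inter> J')) < a) * of_bool (J' - T \<subseteq> G))"
  proof (intro integral_mono)
    fix G
    show "of_bool (spurious_copy n J a T (T \<union> G)) \<le>
      (\<Sum>J'\<in>copies n J. of_bool (real (card (T \<inter> J')) < a) * of_bool (J' - T \<subseteq> G) :: real)"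
    proof (cases "spurious_copy n J a T (T \<union> G)")
      case True
      then obtain J' where J': "J' \<in> copies n J" "J' \<subseteq> T \<union> G" "real (card (T \<inter> J')) < a"
        by (auto simp: spurious_copy_def copies_in_def)
      then have "1 = (of_bool (real (card (T \<inter> J')) < a) * of_bool (J' - T \<subseteq> G) :: real)" by auto
      also have "\<dots> \<le> (\<Sum>J'\<in>copies n J. of_bool (real (card (T \<inter> J')) < a) * of_bool (J' - T \<subseteq> G))"
        by (rule member_le_sum[OF J'(1)]) (auto simp: finite_copies[OF J])
      finally show ?thesis by simp
    qed (auto intro!: sum_nonneg)
  qed auto
  also have "\<dots> = (\<Sum>J'\<in>copies n J. of_bool (real (card (T \<inter> J')) < a) * ?E (\<lambda>G. of_bool (J' - T \<subseteq> G)))"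
    by (simp add: Bochner_Integration.integral_sum)
  also have "\<dots> = (\<Sum>J'\<in>copies n J. of_bool (real (card (T \<inter> J')) < a) * p ^ card (J' - T))"
    using copies_subset_complete_graph[OF J]
    by (intro sum.cong refl arg_cong2[where f = "(*)"] prob_subgraph_erdos_renyi[OF p]) auto
  also have "\<dots> \<le> (\<Sum>J'\<in>copies n J. D * (1 / real n) ^ (num_verts J - card (\<Union>T \<inter> \<Union>J')))"
    by (intro sum_mono bound)
  also have "\<dots> = D * (\<Sum>J'\<in>copies n J. (1 / real n) ^ (num_verts J - card (\<Union>T \<inter> \<Union>J')))"
    by (simp only: sum_distrib_left)
  also have "\<dots> \<le> D * (real (num_verts T) + 1) ^ num_verts J"
    using sum_copies_missing_le[OF J n Union_subset_vertices[OF T]] D0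
    by (intro mult_left_mono) (auto simp: num_verts_def)
  finally show ?thesis by (simp only: a_def D_def)
qed

text \<open>The estimator is any copy of \<open>J\<close> in the observation. Its squared error is
  |T| + |J| minus twice the overlap: at most |T| - (1 - 2\<eta>) |J| if no copy is spurious, and at
  most 2 |J| more otherwise.\<close>

lemma mmse_le:
  fixes \<eta> \<delta> d :: real
  assumes T: "T \<subseteq> complete_graph n" and J: "J \<subseteq> T" "J \<noteq> {}" and n: "1 \<le> n"
    and d: "0 < d" "density_le T d" "real (card J) = d * real (num_verts J)"
    and \<delta>: "0 < \<delta>" "\<delta> < 1" and \<eta>: "0 \<le> \<eta>"
  defines "p \<equiv> (1 - \<delta>) * real n powr (- 1 / d)"
  shows "mmse n T p \<le> 1 - (1 - 2 * \<eta>) * (real (card J) / real (card T)) +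
    2 * ((1 - \<delta>) powr (\<eta> * real (card J)) * (real (num_verts T) + 1) ^ num_verts J)"
proof -
  let ?Epl = "measure_pmf.expectation (planted_model n T p)"
  define j where "j = real (card J)"
  define m where "m = real (card T)"
  define a where "a = (1 - \<eta>) * j"
  define B where "B = (1 - \<delta>) powr (\<eta> * j) * (real (num_verts T) + 1) ^ num_verts J"
  \<comment> \<open>The choice is well defined on observations, which contain the planted copy and
    hence a copy of \<open>J\<close>.\<close>
  define est where "est G = (SOME J'. J' \<in> copies_in n J G)" for G
  define bad where "bad \<omega> = (of_bool (spurious_copy n J a (fst \<omega>) (observation \<omega>)) :: real)" for \<omega>
  have JK: "J \<subseteq> complete_graph n" using J T by blast
  have q: "0 < real n powr (- 1 / d)" "real n powr (- 1 / d) \<le> 1"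
    using n d(1) powr_mono[of "- 1 / d" 0 "real n"] by auto
  have p: "0 < p" "p \<le> 1" using q \<delta> by (auto simp: p_def intro!: mult_le_one)
  have j0: "0 \<le> j" by (simp add: j_def)
  have m0: "0 < m" using J finite_subgraph[OF T] by (auto simp: m_def card_gt_0_iff)
  have jm: "j \<le> m" unfolding j_def m_def using J finite_subgraph[OF T] by (simp add: card_mono)
  have B0: "0 \<le> B" by (simp add: B_def)
  have "?Epl (\<lambda>\<omega>. \<Sum>e\<in>complete_graph n. (of_bool (e \<in> fst \<omega>) - of_bool (e \<in> est (observation \<omega>)))\<^sup>2) \<le>
      ?Epl (\<lambda>\<omega>. m + j - 2 * a + 2 * j * bad \<omega>)"
  proof (intro integral_mono_AE integrable_planted_model[OF T] AE_pmfI)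
    fix \<omega> assume "\<omega> \<in> set_pmf (planted_model n T p)"
    moreover have "copies n T \<noteq> {}" using self_mem_copies by blast
    ultimately have T': "fst \<omega> \<in> copies n T"
      using finite_copies[OF T] by (auto simp: planted_model_def)
    obtain J0 where J0: "J0 \<in> copies n J" "J0 \<subseteq> fst \<omega>" using copies_mono[OF T' J(1)] by blast
    then have "J0 \<in> copies_in n J (observation \<omega>)" by (auto simp: copies_in_def observation_def)
    then have est: "est (observation \<omega>) \<in> copies_in n J (observation \<omega>)"
      unfolding est_def by (rule someI)
    then have est': "est (observation \<omega>) \<in> copies n J" by (simp add: copies_in_def)
    have "(\<Sum>e\<in>complete_graph n. (of_bool (e \<in> fst \<omega>) - of_bool (e \<in> est (observation \<omega>)))\<^sup>2) =
        m + j - 2 * real (card (fst \<omega> \<inter> est (observation \<omega>)))"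
      using sum_sq_diff_indicator[OF copies_subset_complete_graph[OF T T']
          copies_subset_complete_graph[OF JK est']] card_copy[OF T'] card_copy[OF est']
      by (simp add: m_def j_def)
    also have "\<dots> \<le> m + j - 2 * a + 2 * j * bad \<omega>"
    proof (cases "real (card (fst \<omega> \<inter> est (observation \<omega>))) < a")
      case True
      then have "bad \<omega> = 1" using est by (auto simp: bad_def spurious_copy_def)
      moreover have "a \<le> j" using \<eta> j0 by (simp add: a_def left_diff_distrib)
      ultimately show ?thesis by simp
    next
      case False
      then show ?thesis using j0 by (simp add: bad_def)
    qed
    finally show "(\<Sum>e\<in>complete_graph n. (of_bool (e \<in> fst \<omega>) - of_bool (e \<in> est (observation \<omega>)))\<^sup>2) \<le>
      m + j - 2 * a + 2 * j * bad \<omega>" .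
  qed
  also have "\<dots> = m + j - 2 * a + 2 * j * ?Epl bad"
    by (simp add: integrable_planted_model[OF T])
  also have "?Epl bad \<le> B"
  proof -
    have "?Epl bad = (\<Sum>T'\<in>copies n T. measure_pmf.expectation (erdos_renyi n p)
        (\<lambda>G. of_bool (spurious_copy n J a T' (T' \<union> G)))) / real (card (copies n T))"
      by (simp add: expectation_planted_model[OF T] bad_def observation_def)
    also have "\<dots> \<le> (\<Sum>T'\<in>copies n T. B) / real (card (copies n T))"
    proof (intro divide_right_mono sum_mono)
      fix T' assume T': "T' \<in> copies n T"
      show "measure_pmf.expectation (erdos_renyi n p)
          (\<lambda>G. of_bool (spurious_copy n J a T' (T' \<union> G))) \<le> B"
        using prob_spurious_copy_le[OF copies_subset_complete_graph[OF T T'] JK n d(1)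
          density_le_copy[OF d(2) T'] d(3) \<delta>, of \<eta>] num_verts_copy[OF T']
        by (simp add: p_def a_def j_def B_def)
    qed simp
    also have "\<dots> = B" using card_copies_pos[OF T] by simp
    finally show ?thesis .
  qed
  finally have "?Epl (\<lambda>\<omega>. \<Sum>e\<in>complete_graph n. (of_bool (e \<in> fst \<omega>) - of_bool (e \<in> est (observation \<omega>)))\<^sup>2) \<le>
      m + j - 2 * a + 2 * j * B"
    using j0 by (simp add: mult_left_mono)
  \<comment> \<open>Enlarging \<open>j\<close> to \<open>m\<close> in the error term leaves
    \<open>2 * B\<close> after division by \<open>m\<close>.\<close>
  also have "\<dots> \<le> m + j - 2 * a + 2 * m * B"
    using jm B0 by (simp add: mult_right_mono)
  finally have "mmse n T p \<le> (m + j - 2 * a + 2 * m * B) / m"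
    using mmse_le_estimator[OF p T, of est] m0
    by (intro order_trans[OF mmse_le_estimator[OF p T, of est]]) (simp add: m_def divide_right_mono)
  also have "\<dots> = 1 - (1 - 2 * \<eta>) * (j / m) + 2 * B"
    using m0 by (simp add: a_def field_simps)
  finally show ?thesis by (simp only: j_def m_def B_def)
qed

section \<open>Asymptotics\<close>

lemma succ_le_square:
  fixes v :: real
  assumes "2 \<le> v"
  shows "v + 1 \<le> v\<^sup>2"
proof -
  have "2 * v \<le> v * v" using assms by (intro mult_right_mono) auto
  then show ?thesis using assms unfolding power2_eq_square by linarith
qed

lemma ln_ge_half: "2 \<le> (v::real) \<Longrightarrow> 1 / 2 \<le> ln v"
  using ln2_ge_two_thirds ln_mono[of 2 v] by linarith

text \<open>With x = k ln k the entropy factor is at most k^(3k) = exp(3x), which the 3 in the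
  hypothesis absorbs. The remaining 2 K x is at least K, since k >= 2 gives x >= 1.\<close>

lemma overlap_error_le:
  fixes b K m :: real and k :: nat
  assumes k: "2 \<le> k" and K: "0 \<le> K"
    and m: "(3 + 2 * K) * (real k * ln (real k)) \<le> b * m"
  shows "(real k * (real k + 1)) ^ k * exp (- (b * m)) \<le> exp (- K)"
proof -
  define x where "x = real k * ln (real k)"
  have "2 * (1 / 2) \<le> x"
    unfolding x_def using k ln_ge_half[of "real k"] by (intro mult_mono) auto
  then have x: "1 \<le> x" by simp
  have "real k * (real k + 1) \<le> real k ^ 3"
    using k mult_left_mono[OF succ_le_square[of "real k"], of "real k"]
    by (simp add: power3_eq_cube power2_eq_square mult.assoc)
  then have "(real k * (real k + 1)) ^ k \<le> (real k ^ 3) ^ k"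
    by (intro power_mono) auto
  also have "\<dots> = exp (ln (real k)) ^ (3 * k)"
    using k by (simp add: power_mult)
  also have "\<dots> = exp (3 * x)"
    by (simp add: x_def mult_ac flip: exp_of_nat_mult)
  finally have "(real k * (real k + 1)) ^ k * exp (- (b * m)) \<le> exp (3 * x) * exp (- (b * m))"
    by (intro mult_right_mono) auto
  also have "\<dots> = exp (3 * x - b * m)" by (simp add: exp_diff exp_minus field_simps)
  also have "\<dots> \<le> exp (- K)"
  proof -
    have "(3 + 2 * K) * x \<le> b * m" using m by (simp add: x_def)
    moreover have "2 * K * 1 \<le> 2 * K * x" using x K by (intro mult_left_mono) auto
    ultimately have "3 * x - b * m \<le> - K" using K by (simp add: distrib_right)
    then show ?thesis by simp
  qed
  finally show ?thesis .
qed

text \<open>Per vertex, k + 1 <= k^2 costs 2 ln k, covered by 3 ln k; what remains is at least 2 K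
  ln k >= K, since ln k >= 1/2. As this exponent is at most -K <= 0, the power l >= 1 only
  helps.\<close>

lemma spurious_error_le:
  fixes b K d :: real and k l :: nat
  assumes k: "2 \<le> k" and l: "1 \<le> l" and K: "0 \<le> K"
    and d: "(3 + 2 * K) * ln (real k) \<le> b * d"
  shows "exp (- (b * (d * real l))) * (real k + 1) ^ l \<le> exp (- K)"
proof -
  define x where "x = ln (real k)"
  have x: "1 / 2 \<le> x" unfolding x_def using k by (intro ln_ge_half) simp
  have "exp (- (b * (d * real l))) * (real k + 1) ^ l \<le> exp (- (b * (d * real l))) * (real k ^ 2) ^ l"
    using succ_le_square[of "real k"] k by (intro mult_left_mono power_mono) auto
  also have "(real k ^ 2) ^ l = exp (ln (real k)) ^ (2 * l)"
    using k by (simp add: power_mult)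
  also have "\<dots> = exp (2 * x * real l)"
    by (simp add: x_def mult_ac flip: exp_of_nat_mult)
  also have "exp (- (b * (d * real l))) * exp (2 * x * real l) = exp ((2 * x - b * d) * real l)"
    by (simp add: algebra_simps flip: exp_add)
  also have "\<dots> \<le> exp (- K)"
  proof -
    have "(3 + 2 * K) * x \<le> b * d" using d by (simp add: x_def)
    moreover have "2 * K * (1 / 2) \<le> 2 * K * x" using x K by (intro mult_left_mono) auto
    ultimately have *: "2 * x - b * d \<le> - K" using x by (simp add: distrib_right)
    then have "(2 * x - b * d) * real l \<le> (2 * x - b * d) * 1"
      using l K by (intro mult_left_mono_neg) auto
    then show ?thesis using * by simp
  qed
  finally show ?thesis .
qed

text \<open>An infinite liminf is a limit, so the ratio eventually exceeds every constant;
  multiplying out needs v ln v > 0, which v >= 2 provides.\<close>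

lemma weakly_dense_eventually:
  assumes "weakly_dense H"
  shows "eventually (\<lambda>n. C * (real (num_verts (H n)) * ln (real (num_verts (H n)))) \<le> real (card (H n)))
    sequentially"
proof -
  have H: "H n \<subseteq> complete_graph n" "H n \<noteq> {}" if "2 \<le> n" for n
    using assms that by (auto simp: weakly_dense_def)
  have "liminf (\<lambda>n. ereal (real (card (H n)) /
       (real (num_verts (H n)) * ln (real (num_verts (H n)))))) = \<infinity>"
    using assms by (simp add: weakly_dense_def)
  then have "((\<lambda>n. ereal (real (card (H n)) /
       (real (num_verts (H n)) * ln (real (num_verts (H n)))))) \<longlongrightarrow> \<infinity>) sequentially"
    by (simp add: Liminf_PInfty)
  then have "eventually (\<lambda>n. ereal C < ereal (real (card (H n)) /
       (real (num_verts (H n)) * ln (real (num_verts (H n)))))) sequentially"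
    unfolding tendsto_PInfty by blast
  then show ?thesis
    using eventually_ge_at_top[of 2]
  proof eventually_elim
    case (elim n)
    have "2 \<le> num_verts (H n)" by (rule num_verts_ge_2[OF H[OF elim(2)]])
    then have "0 < real (num_verts (H n)) * ln (real (num_verts (H n)))"
      using ln_ge_half[of "real (num_verts (H n))"] by simp
    then show ?case using elim(1) by (simp add: field_simps)
  qed
qed

section \<open>The densest subgraph and the subgraph expectation threshold\<close>

lemma maximal_density:
  assumes T: "T \<subseteq> complete_graph n"
    and J: "is_arg_max (\<lambda>J. real (card J) / real (num_verts J)) (\<lambda>J. J \<noteq> {} \<and> J \<subseteq> T) J"
  defines "d \<equiv> real (card J) / real (num_verts J)"
  shows "0 < d" "density_le T d" "real (card J) = d * real (num_verts J)"
proof -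
  have JT: "J \<subseteq> T" "J \<noteq> {}" using J by (auto simp: is_arg_max_def)
  have pos: "0 < real (card S)" "0 < real (num_verts S)" if "S \<subseteq> T" "S \<noteq> {}" for S
  proof -
    have S: "S \<subseteq> complete_graph n" using that T by blast
    show "0 < real (card S)" using finite_subgraph[OF S] that by (simp add: card_gt_0_iff)
    show "0 < real (num_verts S)" using num_verts_ge_2[OF S that(2)] by simp
  qed
  show "0 < d" "real (card J) = d * real (num_verts J)" using pos[OF JT] by (auto simp: d_def)
  show "density_le T d"
    unfolding density_le_def
  proof (intro allI impI)
    fix S assume S: "S \<subseteq> T"
    show "real (card S) \<le> d * real (num_verts S)"
    proof (cases "S = {}")
      case False
      then have "real (card S) / real (num_verts S) \<le> d"
        using J S unfolding is_arg_max_def d_def by (meson not_less)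
      then show ?thesis using pos(2)[OF S False] by (simp add: field_simps)
    qed (simp add: num_verts_def)
  qed
qed

text \<open>For n >= 1 the quantity n^(-v/e) increases with the density e/v, so the densest subgraph
  attains the maximum.\<close>

lemma subgraph_expectation_threshold_eq:
  assumes T: "H n \<subseteq> complete_graph n" and n: "1 \<le> n"
    and J: "is_arg_max (\<lambda>J. real (card J) / real (num_verts J)) (\<lambda>J. J \<noteq> {} \<and> J \<subseteq> H n) J"
  shows "subgraph_expectation_threshold H n =
    real n powr (- 1 / (real (card J) / real (num_verts J)))"
  unfolding subgraph_expectation_threshold_def
proof (rule Max_eqI)
  define d where "d = real (card J) / real (num_verts J)"
  note md = maximal_density[OF T J, folded d_def]
  have JT: "J \<subseteq> H n" "J \<noteq> {}" using J by (auto simp: is_arg_max_def)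
  have "finite (Pow (H n))" using finite_subgraph[OF T] by simp
  then show "finite ((\<lambda>J. real n powr (- (real (num_verts J) / real (card J)))) ` {J. J \<noteq> {} \<and> J \<subseteq> H n})"
    by (intro finite_imageI finite_subset[of "{J. J \<noteq> {} \<and> J \<subseteq> H n}" "Pow (H n)"]) auto
  show "real n powr (- 1 / (real (card J) / real (num_verts J))) \<in>
      (\<lambda>J. real n powr (- (real (num_verts J) / real (card J)))) ` {J. J \<noteq> {} \<and> J \<subseteq> H n}"
    using JT by (intro image_eqI[of _ _ J]) auto
  fix y assume "y \<in> (\<lambda>J. real n powr (- (real (num_verts J) / real (card J)))) ` {J. J \<noteq> {} \<and> J \<subseteq> H n}"
  then obtain S where S: "S \<noteq> {}" "S \<subseteq> H n" and y: "y = real n powr (- (real (num_verts S) / real (card S)))"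
    by auto
  have "0 < real (card S)" using finite_subgraph[OF T] S finite_subset by (auto simp: card_gt_0_iff)
  moreover have "real (card S) \<le> d * real (num_verts S)" using md(2) S by (simp add: density_le_def)
  ultimately have "1 / d \<le> real (num_verts S) / real (card S)"
    using md(1) by (simp add: field_simps)
  then show "y \<le> real n powr (- 1 / (real (card J) / real (num_verts J)))"
    unfolding y d_def[symmetric] using n by (intro powr_mono) auto
qed

section \<open>From the MMSE bounds to the sharp threshold\<close>

lemma asymp_equiv_sandwichI:
  fixes f g :: "nat \<Rightarrow> real"
  assumes pos: "eventually (\<lambda>n. 0 < g n) sequentially"
    and le: "\<And>\<delta>. 0 < \<delta> \<Longrightarrow> \<delta> < 1 \<Longrightarrow>
      eventually (\<lambda>n. (1 - \<delta>) * g n \<le> f n \<and> f n \<le> (1 + \<delta>) * g n) sequentially"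
  shows "f \<sim>[sequentially] g"
proof (rule asymp_equivI', rule tendstoI)
  fix e :: real assume e: "0 < e"
  \<comment> \<open>Strictly below \<open>e\<close>, and below 1 so that \<open>le\<close>
    applies.\<close>
  define \<delta> where "\<delta> = min (e / 2) (1 / 2)"
  have \<delta>: "0 < \<delta>" "\<delta> < 1" "\<delta> < e" using e by (auto simp: \<delta>_def)
  show "eventually (\<lambda>n. dist (f n / g n) 1 < e) sequentially"
    using pos le[OF \<delta>(1,2)]
  proof eventually_elim
    case (elim n)
    then have "1 - \<delta> \<le> f n / g n" "f n / g n \<le> 1 + \<delta>" by (auto simp: field_simps)
    then show ?case using \<delta> by (simp add: dist_real_def abs_if)
  qed
qed

theorem corollary1p3:
  fixes H J1 :: "nat \<Rightarrow> graph"
  assumes "weakly_dense H"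
    and "\<And>n. n \<ge> 2 \<Longrightarrow>
      is_arg_max (\<lambda>J. real (card J) / real (num_verts J)) (\<lambda>J. J \<noteq> {} \<and> J \<subseteq> H n) (J1 n)"
    and "(\<lambda>n. real (card (J1 n)) / real (card (H n))) \<in> \<Omega>(\<lambda>_. 1)"
  shows "has_sharp_weak_recovery_threshold H \<and>
    is_weak_recovery_threshold H (subgraph_expectation_threshold H)"
proof -
  define d where "d n = real (card (J1 n)) / real (num_verts (J1 n))" for n
  define q where "q = subgraph_expectation_threshold H"
  have H: "H n \<subseteq> complete_graph n" "H n \<noteq> {}" if "2 \<le> n" for n
    using assms(1) that by (auto simp: weakly_dense_def)
  have J: "J1 n \<subseteq> H n" "J1 n \<noteq> {}" if "2 \<le> n" for n
    using assms(2)[OF that] by (auto simp: is_arg_max_def)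
  have d: "0 < d n" "density_le (H n) (d n)" "real (card (J1 n)) = d n * real (num_verts (J1 n))"
    if "2 \<le> n" for n
    using maximal_density[OF H(1)[OF that] assms(2)[OF that]] by (auto simp: d_def)
  have q: "q n = real n powr (- 1 / d n)" if "2 \<le> n" for n
    using subgraph_expectation_threshold_eq[of H n, OF H(1)[OF that] _ assms(2)[OF that]] that
    by (simp add: q_def d_def)
  \<comment> \<open>\<open>c\<close> is an eventual lower bound on q_1; the level used for sharpness
    will be c/4.\<close>
  obtain c where c: "0 < c"
    and "eventually (\<lambda>n. c * norm (1::real) \<le> norm (real (card (J1 n)) / real (card (H n)))) sequentially"
    using landau_omega.bigE[OF assms(3)] by blast
  then have c_ev: "eventually (\<lambda>n. c \<le> real (card (J1 n)) / real (card (H n))) sequentially"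
    by simp
  \<comment> \<open>The claim does not mention n, so a single large n proves it; it makes c/4 a
    level below 1.\<close>
  have "eventually (\<lambda>n::nat. c \<le> 1) sequentially"
    using c_ev eventually_ge_at_top[of 2]
  proof eventually_elim
    case (elim n)
    have "card (J1 n) \<le> card (H n)"
      using J[OF elim(2)] finite_subgraph[OF H(1)[OF elim(2)]] by (intro card_mono) auto
    then have "real (card (J1 n)) / real (card (H n)) \<le> 1" by (auto simp: divide_le_eq_1)
    then show ?case using elim(1) by linarith
  qed
  then have c1: "c \<le> 1" by simp

  \<comment> \<open>\<open>mmse_le\<close> with \<eta> = 1/4 gives 1 - c/2 plus twice the error, so
    an error of at most c/8 suffices for 1 - c/4.\<close>
  have recovery: "eventually (\<lambda>n. mmse n (H n) ((1 - \<delta>) * q n) \<le> 1 - c / 4) sequentially"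
    if \<delta>: "0 < \<delta>" "\<delta> < 1" for \<delta>
  proof -
    \<comment> \<open>\<open>K\<close> makes the error at most c/8, the maximum ensuring K >= 0;
      \<open>b\<close> turns (1-\<delta>)^(|J|/4) into exp(-b |J|).\<close>
    define K where "K = max 0 (- ln (c / 8))"
    define b where "b = - ln (1 - \<delta>) / 4"
    have K: "0 \<le> K" "exp (- K) \<le> c / 8"
    proof -
      have "exp (- K) \<le> exp (ln (c / 8))" unfolding K_def by simp
      then show "exp (- K) \<le> c / 8" using c by simp
    qed (simp add: K_def)
    have b: "0 < b" using \<delta> by (simp add: b_def)
    show ?thesis
      using c_ev weakly_dense_eventually[OF assms(1), of "(3 + 2 * K) / b"] eventually_ge_at_top[of 2]
    proof eventually_elim
      case (elim n)
      define k where "k = num_verts (H n)"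
      define l where "l = num_verts (J1 n)"
      have k: "2 \<le> k" unfolding k_def by (rule num_verts_ge_2[OF H[OF elim(3)]])
      have l: "1 \<le> l"
        using num_verts_ge_2[OF order_trans[OF J(1) H(1)] J(2), of n] elim(3) by (simp add: l_def)
      \<comment> \<open>The maximal density is at least the density of \<open>H n\<close> itself, so
        weak density makes \<open>d n\<close> exceed any multiple of ln k.\<close>
      have "(3 + 2 * K) / b * (real k * ln (real k)) \<le> d n * real k"
        using elim(2) d(2)[OF elim(3)] by (auto simp: k_def density_le_def)
      then have "real k * ((3 + 2 * K) * ln (real k)) \<le> real k * (b * d n)"
        using b by (simp add: field_simps)
      then have "(3 + 2 * K) * ln (real k) \<le> b * d n" using k by simp
      note small = spurious_error_le[OF k l K(1) this]
      have "(1 - \<delta>) powr (1 / 4 * real (card (J1 n))) = exp (- (b * (d n * real l)))"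
        using \<delta> d(3)[OF elim(3)] by (simp add: powr_def b_def l_def)
      then have "mmse n (H n) ((1 - \<delta>) * q n) \<le>
          1 - (1 - 2 * (1 / 4)) * (real (card (J1 n)) / real (card (H n))) +
          2 * (exp (- (b * (d n * real l))) * (real k + 1) ^ l)"
        using mmse_le[OF H(1)[OF elim(3)] J[OF elim(3)] _ d[OF elim(3)] \<delta>, of "1 / 4"] elim(3)
        by (simp add: q k_def l_def)
      also have "\<dots> \<le> 1 - (1 - 2 * (1 / 4)) * c + 2 * (c / 8)"
        using small K(2) elim(1) by (intro add_mono diff_mono mult_left_mono) auto
      finally show ?case by simp
    qed
  qed

  \<comment> \<open>\<open>mmse_ge\<close> with \<eta> = t = \<epsilon>/4; the third error is also
    at most \<epsilon>/4, a total of 3\<epsilon>/4 < \<epsilon>. The bound is uniform in p because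
    its error terms do not involve p.\<close>
  have impossible: "eventually (\<lambda>n. \<forall>p. (1 + \<delta>) * q n \<le> p \<and> p \<le> 1 \<longrightarrow> 1 - \<epsilon> < mmse n (H n) p) sequentially"
    if \<delta>: "0 < \<delta>" and \<epsilon>: "0 < \<epsilon>" for \<delta> \<epsilon>
  proof -
    \<comment> \<open>The third error is divided by t = \<epsilon>/4, hence the target
      (\<epsilon>/4)^2.\<close>
    define K where "K = max 0 (- ln (\<epsilon> / 4 * (\<epsilon> / 4)))"
    define b where "b = \<epsilon> / 4 * ln (1 + \<delta>)"
    have K: "0 \<le> K" "exp (- K) \<le> \<epsilon> / 4 * (\<epsilon> / 4)"
    proof -
      have "exp (- K) \<le> exp (ln (\<epsilon> / 4 * (\<epsilon> / 4)))" unfolding K_def by simp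
      then show "exp (- K) \<le> \<epsilon> / 4 * (\<epsilon> / 4)" using \<epsilon> by (subst (asm) exp_ln) auto
    qed (simp add: K_def)
    have b: "0 < b" using \<delta> \<epsilon> by (simp add: b_def)
    show ?thesis
      using weakly_dense_eventually[OF assms(1), of "(3 + 2 * K) / b"] eventually_ge_at_top[of 2]
    proof eventually_elim
      case (elim n)
      define k where "k = num_verts (H n)"
      define m where "m = real (card (H n))"
      have k: "2 \<le> k" unfolding k_def by (rule num_verts_ge_2[OF H[OF elim(2)]])
      have "(3 + 2 * K) * (real k * ln (real k)) \<le> b * m"
        using elim(1) b by (simp add: k_def m_def field_simps)
      note small = order_trans[OF overlap_error_le[OF k K(1) this] K(2)]
      have D: "(1 + \<delta>) powr (- (\<epsilon> / 4 * m)) = exp (- (b * m))"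
        using \<delta> by (simp add: powr_def b_def)
      show ?case
      proof (intro allI impI)
        fix p assume p: "(1 + \<delta>) * q n \<le> p \<and> p \<le> 1"
        have "1 - \<epsilon> < 1 - \<epsilon> / 4 - \<epsilon> / 4 - \<epsilon> / 4" using \<epsilon> by simp
        also have "\<dots> \<le> 1 - \<epsilon> / 4 - \<epsilon> / 4 - (real k * (real k + 1)) ^ k * exp (- (b * m)) / (\<epsilon> / 4)"
        proof -
          have "(real k * (real k + 1)) ^ k * exp (- (b * m)) / (\<epsilon> / 4) \<le> \<epsilon> / 4"
            using small \<epsilon> by (subst pos_divide_le_eq) auto
          then show ?thesis by linarith
        qed
        also have "\<dots> \<le> mmse n (H n) p"
          using mmse_ge[OF H[OF elim(2)] _ d(1,2)[OF elim(2)], of \<delta> p "\<epsilon> / 4" "\<epsilon> / 4"] p \<epsilon> \<delta> D elim(2)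
          by (simp add: q k_def m_def)
        finally show "1 - \<epsilon> < mmse n (H n) p" .
      qed
    qed
  qed

  \<comment> \<open>For \<epsilon> <= c/4 the recovery bound 1 - c/4 is at most 1 -
    \<epsilon>.\<close>
  have equiv: "p_level H \<epsilon> \<sim>[sequentially] q" if \<epsilon>: "0 < \<epsilon>" "\<epsilon> \<le> c / 4" for \<epsilon>
  proof (rule asymp_equiv_sandwichI)
    show "eventually (\<lambda>n. 0 < q n) sequentially"
      using eventually_ge_at_top[of 2] by eventually_elim (simp add: q)
    fix \<delta> :: real assume \<delta>: "0 < \<delta>" "\<delta> < 1"
    show "eventually (\<lambda>n. (1 - \<delta>) * q n \<le> p_level H \<epsilon> n \<and> p_level H \<epsilon> n \<le> (1 + \<delta>) * q n) sequentially"
      using recovery[OF \<delta>] impossible[OF \<delta>(1) \<epsilon>(1)] eventually_ge_at_top[of 2]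
    proof eventually_elim
      case (elim n)
      define S where "S = {p \<in> {0..1}. mmse n (H n) p \<le> 1 - \<epsilon>}"
      have qn: "0 < q n" "q n \<le> 1"
        using elim(3) d(1)[OF elim(3)] powr_mono[of "- 1 / d n" 0 "real n"] by (auto simp: q)
      \<comment> \<open>This element makes \<open>S\<close> nonempty and bounds its supremum from
        below; \<open>impossible\<close> bounds every element from above.\<close>
      have "(1 - \<delta>) * q n \<in> S"
        using elim(1) \<epsilon>(2) qn \<delta> by (auto simp: S_def intro!: mult_le_one)
      moreover have "bdd_above S" by (rule bdd_aboveI[of _ 1]) (auto simp: S_def)
      moreover have "p \<le> (1 + \<delta>) * q n" if "p \<in> S" for p
      proof (rule ccontr)
        assume "\<not> p \<le> (1 + \<delta>) * q n"
        then have "1 - \<epsilon> < mmse n (H n) p" using elim(2) that by (simp add: S_def)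
        then show False using that by (simp add: S_def)
      qed
      ultimately have "(1 - \<delta>) * q n \<le> Sup S" "Sup S \<le> (1 + \<delta>) * q n"
        by (auto intro: cSup_upper cSup_least)
      then show ?case by (simp add: p_level_def S_def)
    qed
  qed

  have "sharp_level H (c / 4)"
    unfolding sharp_level_def
  proof (intro conjI allI impI)
    fix \<epsilon> assume "0 < \<epsilon> \<and> \<epsilon> < c / 4"
    then show "p_level H \<epsilon> \<sim>[sequentially] p_level H (c / 4)"
      using c by (intro asymp_equiv_trans[OF equiv asymp_equiv_symI[OF equiv]]) auto
  qed (use c c1 in auto)
  moreover have "p_level H \<epsilon>0 \<sim>[sequentially] q" if s: "sharp_level H \<epsilon>0" for \<epsilon>0
  proof -
    \<comment> \<open>A level strictly below \<epsilon>0 and at most c/4: sharpness links it to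
      \<epsilon>0, and \<open>equiv\<close> links it to \<open>q\<close>.\<close>
    define \<epsilon> where "\<epsilon> = min \<epsilon>0 (c / 4) / 2"
    have \<epsilon>: "0 < \<epsilon>" "\<epsilon> < \<epsilon>0" "\<epsilon> \<le> c / 4" using s c by (auto simp: \<epsilon>_def sharp_level_def)
    have "p_level H \<epsilon> \<sim>[sequentially] p_level H \<epsilon>0" using s \<epsilon> by (simp add: sharp_level_def)
    then show ?thesis by (rule asymp_equiv_trans[OF asymp_equiv_symI equiv[OF \<epsilon>(1,3)]])
  qed
  ultimately show ?thesis
    unfolding is_weak_recovery_threshold_def has_sharp_weak_recovery_threshold_def q_def by blast
qed

end
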